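(* Let $f_k(x;y_1,\dots,y_n)$ ($k=1,\dots,n$) be given smooth functions, and consider the initial value problem $$\frac{dy_k}{dx}=f_k(x;y_1,\dots,y_n),\qquad y_k(x_0)=y_{k0}\qquad (k=1,\dots,n),$$ where $\mathbf{y}_0=(y_{10},\dots,y_{n0})^T$ is given. Put $$z_k=y_{k0}+(x-x_0)f_k(x_0;\mathbf{y}_0)\qquad(k=1,\dots,n).$$ If $$f_k(x;z_1,\dots,z_n)-f_k(x_0;y_{10},\dots,y_{n0})\neq 0\qquad (k=1,\dots,n),$$ then the exact solution of the initial value problem is expressed as $$y_k(x)=y_{k0}+(x-x_0)\bigl[\alpha_k f_k(x_0;\mathbf{y}_0)+(1-\alpha_k)f_k(x;z_1,\dots,z_n)\bigr]\qquad(k=1,\dots,n),$$ with $$\alpha_k=1-\frac{\sum_{m=2}^{\infty}\frac{(x-x_0)^{m-1}}{m!}\,(D^{m-1}f_k)(x_0;y_{10},\dots,y_{n0})}{f_k(x;z_1,\dots,z_n)-f_k(x_0;y_{10},\dots,y_{n0})}\qquad(k=1,\dots,n),$$ where $$D=\frac{\partial}{\partial x}+f_1\frac{\partial}{\partial y_1}+f_2\frac{\partial}{\partial y_2}+\cdots+f_n\frac{\partial}{\partial y_n}.$$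
   Context: The unknowns are the functions $y_1(x),\dots,y_n(x)$, with $\mathbf{y}=(y_1,\dots,y_n)^T$, and $f_k(x;\mathbf{y})$ means $f_k(x;y_1,\dots,y_n)$. The operator $D$ is a first-order differential operator acting on smooth functions of the variables $(x,y_1,\dots,y_n)$; $D^{m-1}$ is its $(m-1)$-fold iterate, and $(D^{m-1}f_k)(x_0;y_{10},\dots,y_{n0})$ denotes the function $D^{m-1}f_k$ evaluated at the point $(x_0,y_{10},\dots,y_{n0})$. The quantities $z_k$ and $\alpha_k$ depend on $x$.
   Formalization: "Smooth" is taken as real analytic (for merely smooth f the claim fails, e.g. f = exp(-1/x²), x0 = y0 = 0), and the formula is asserted at those x where the series in α_k converges; convergence for x near x0 is proved. *)

theory Defs
  imports "HOL-Analysis.Analysis"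
begin

text \<open>
  The right-hand sides are a family \<open>f k\<close> of functions of \<open>(x, y)\<close>, with the components
  of \<open>y :: real ^ 'n\<close> in the role of \<open>y\<^sub>1, \<dots>, y\<^sub>n\<close>.

  Smoothness of the right-hand sides is taken to be real analyticity. With mere infinite
  differentiability the Taylor series at the initial point need not represent the solution: for
  \<open>n = 1\<close>, \<open>f(x; y) = exp (-1 / x\<^sup>2)\<close> (and \<open>0\<close> at \<open>x = 0\<close>), \<open>x\<^sub>0 = y\<^sub>0 = 0\<close>, every
  coefficient \<open>(D\<^sup>m f)(0; 0)\<close> vanishes although the solution is not constant.
\<close>

text \<open>
  A power series in \<open>1 + n\<close> variables: the exponents form a multi-index
  \<open>(j, a) \<in> nat \<times> ('n \<Rightarrow> nat)\<close>, and the sum is unconditional.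
\<close>

definition real_analytic_at :: "(real \<Rightarrow> real ^ 'n \<Rightarrow> real) \<Rightarrow> real \<Rightarrow> real ^ 'n \<Rightarrow> bool" where
  "real_analytic_at g x y \<longleftrightarrow>
     (\<exists>(c :: nat \<times> ('n \<Rightarrow> nat) \<Rightarrow> real) r. r > 0 \<and>
       (\<forall>t u. \<bar>t - x\<bar> < r \<and> (\<forall>i. \<bar>u $ i - y $ i\<bar> < r) \<longrightarrow>
         ((\<lambda>(j, a). c (j, a) * (t - x) ^ j * (\<Prod>i\<in>UNIV. (u $ i - y $ i) ^ a i))
            has_sum g t u) UNIV))"

definition real_analytic_on ::
    "(real \<Rightarrow> real ^ 'n \<Rightarrow> real) \<Rightarrow> (real \<times> (real ^ 'n)) set \<Rightarrow> bool" where
  "real_analytic_on g U \<longleftrightarrow> (\<forall>(x, y)\<in>U. real_analytic_at g x y)"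

definition partial_x :: "(real \<Rightarrow> real ^ 'n \<Rightarrow> real) \<Rightarrow> real \<Rightarrow> real ^ 'n \<Rightarrow> real" where
  "partial_x g x y = deriv (\<lambda>t. g t y) x"

definition partial_y :: "'n \<Rightarrow> (real \<Rightarrow> real ^ 'n \<Rightarrow> real) \<Rightarrow> real \<Rightarrow> real ^ 'n \<Rightarrow> real" where
  "partial_y i g x y = deriv (\<lambda>t. g x (\<chi> j. if j = i then t else y $ j)) (y $ i)"

definition D_op ::
    "('n \<Rightarrow> real \<Rightarrow> real ^ 'n \<Rightarrow> real) \<Rightarrow> (real \<Rightarrow> real ^ 'n \<Rightarrow> real) \<Rightarrow>
      real \<Rightarrow> real ^ 'n \<Rightarrow> real" where
  "D_op f g = (\<lambda>x y. partial_x g x y + (\<Sum>i\<in>UNIV. f i x y * partial_y i g x y))"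

text \<open>
  A solution lives on an arbitrary interval \<open>I\<close> around the initial abscissa, with one-sided
  derivatives at those end points that belong to \<open>I\<close>; \<open>U\<close> is the domain of the \<open>f k\<close>.
\<close>

definition solves_ivp ::
    "('n \<Rightarrow> real \<Rightarrow> real ^ 'n \<Rightarrow> real) \<Rightarrow> (real \<times> (real ^ 'n)) set \<Rightarrow> real \<Rightarrow> real ^ 'n \<Rightarrow>
      real set \<Rightarrow> (real \<Rightarrow> real ^ 'n) \<Rightarrow> bool" where
  "solves_ivp f U x0 y0 I y \<longleftrightarrow>
     is_interval I \<and> x0 \<in> I \<and> y x0 = y0 \<and>
     (\<forall>x\<in>I. (x, y x) \<in> U \<and>
       (\<forall>k. ((\<lambda>t. y t $ k) has_real_derivative f k x (y x)) (at x within I)))"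

definition euler_z ::
    "('n \<Rightarrow> real \<Rightarrow> real ^ 'n \<Rightarrow> real) \<Rightarrow> real \<Rightarrow> real ^ 'n \<Rightarrow> real \<Rightarrow> real ^ 'n" where
  "euler_z f x0 y0 x = (\<chi> k. y0 $ k + (x - x0) * f k x0 y0)"

text \<open>The term of index \<open>m\<close>; the series in \<open>\<alpha>\<^sub>k\<close> runs over \<open>m \<ge> 2\<close>.\<close>

definition D_term ::
    "('n \<Rightarrow> real \<Rightarrow> real ^ 'n \<Rightarrow> real) \<Rightarrow> real \<Rightarrow> real ^ 'n \<Rightarrow> 'n \<Rightarrow> real \<Rightarrow> nat \<Rightarrow> real" where
  "D_term f x0 y0 k x m =
     (x - x0) ^ (m - 1) / fact m * (D_op f ^^ (m - 1)) (f k) x0 y0"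

definition alpha ::
    "('n \<Rightarrow> real \<Rightarrow> real ^ 'n \<Rightarrow> real) \<Rightarrow> real \<Rightarrow> real ^ 'n \<Rightarrow> 'n \<Rightarrow> real \<Rightarrow> real" where
  "alpha f x0 y0 k x =
     1 - (\<Sum>m. D_term f x0 y0 k x (m + 2)) / (f k x (euler_z f x0 y0 x) - f k x0 y0)"

end

theory Submission
  imports Defs "HOL-Complex_Analysis.Conformal_Mappings"
begin

text \<open>
  The weights cancel in the formula: it says that \<open>y\<^sub>k(x)\<close> is the value at \<open>x\<close> of the Taylor series
  of \<open>y\<^sub>k\<close> at \<open>x\<^sub>0\<close>, since \<open>y\<^sub>k\<^sup>(\<^sup>m\<^sup>) = (D\<^sup>m\<^sup>-\<^sup>1 f\<^sub>k)(x; y(x))\<close> by the chain rule.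

  Cauchy estimates on shrinking polydiscs give \<open>|D\<^sup>m f\<^sub>k| \<le> C K\<^sup>m m!\<close> locally uniformly. Hence the
  series converges near \<open>x\<^sub>0\<close>, and by Taylor's theorem \<open>y\<^sub>k\<close> is the sum of its Taylor series near
  every point of the interval. If the series at \<open>x\<^sub>0\<close> converges at \<open>x\<close>, its sum and \<open>y\<^sub>k\<close> agree on
  the half-open segment from \<open>x\<^sub>0\<close> to \<open>x\<close> by the identity theorem, and at \<open>x\<close> itself, which may lie
  on the boundary of the disc of convergence, by Abel's limit theorem.
\<close>

section \<open>Absolutely convergent power series on polydiscs\<close>

text \<open>Coordinates are taken over \<open>Basis\<close> of an arbitrary Euclidean space, so that
  x and the components of y are treated alike once the system is written in autonomous form.\<close>

definition polydisc :: "'a::euclidean_space \<Rightarrow> real \<Rightarrow> 'a set" where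
  "polydisc p \<rho> = {v. \<forall>b\<in>Basis. \<bar>(v - p) \<bullet> b\<bar> < \<rho>}"

definition monomial_at :: "'a::euclidean_space \<Rightarrow> ('a \<Rightarrow> nat) \<Rightarrow> 'a \<Rightarrow> real" where
  "monomial_at p \<alpha> v = (\<Prod>b\<in>Basis. ((v - p) \<bullet> b) ^ \<alpha> b)"

definition total_degree :: "('a::euclidean_space \<Rightarrow> nat) \<Rightarrow> nat" where
  "total_degree \<alpha> = (\<Sum>b\<in>Basis. \<alpha> b)"

text \<open>
  The same multi-index may occur for several \<open>k\<close>. Thus a product of two series is indexed by pairs,
  without collecting equal monomials, and no uniqueness of coefficients is ever needed.
\<close>

definition power_series_bound ::
    "'a::euclidean_space \<Rightarrow> real \<Rightarrow> real \<Rightarrow> ('a \<Rightarrow> real) \<Rightarrow> bool" where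
  "power_series_bound p \<rho> N h \<longleftrightarrow>
     (\<exists>(c :: nat \<Rightarrow> real) \<alpha> A. ((\<lambda>k. \<bar>c k\<bar> * \<rho> ^ total_degree (\<alpha> k)) has_sum A) UNIV \<and> A \<le> N \<and>
        (\<forall>v\<in>polydisc p \<rho>. ((\<lambda>k. c k * monomial_at p (\<alpha> k) v) has_sum h v) UNIV))"

lemma polydisc_eq_box: "polydisc p \<rho> = box (p - \<rho> *\<^sub>R One) (p + \<rho> *\<^sub>R One)"
  by (force simp: polydisc_def box_def abs_less_iff inner_diff_left inner_add_left)

lemma open_polydisc: "open (polydisc p \<rho>)"
  by (simp add: polydisc_eq_box open_box)

lemma convex_polydisc: "convex (polydisc p \<rho>)"
  by (simp add: polydisc_eq_box convex_box)

lemma center_in_polydisc: "0 < \<rho> \<Longrightarrow> p \<in> polydisc p \<rho>"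
  by (simp add: polydisc_def)

lemma polydisc_mono: "\<rho> \<le> \<sigma> \<Longrightarrow> polydisc p \<rho> \<subseteq> polydisc p \<sigma>"
  unfolding polydisc_def by (auto intro: less_le_trans)

lemma abs_monomial_at_le:
  assumes "\<forall>b\<in>Basis. \<bar>(v - p) \<bullet> b\<bar> \<le> \<rho>"
  shows "\<bar>monomial_at p \<alpha> v\<bar> \<le> \<rho> ^ total_degree \<alpha>"
proof -
  have "\<bar>monomial_at p \<alpha> v\<bar> = (\<Prod>b\<in>Basis. \<bar>(v - p) \<bullet> b\<bar> ^ \<alpha> b)"
    by (simp add: monomial_at_def abs_prod power_abs)
  also have "\<dots> \<le> (\<Prod>b\<in>Basis. \<rho> ^ \<alpha> b)"
    using assms by (intro prod_mono) (auto intro: power_mono)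
  finally show ?thesis
    by (simp add: total_degree_def power_sum)
qed

text \<open>A predicate cannot quantify over index types, so \<open>power_series_bound\<close> fixes
  \<open>nat\<close>. Padding with zeros off the range of \<open>to_nat\<close> brings any countable
  family into that form.\<close>

lemma has_sum_from_nat:
  fixes g :: "'k::countable \<Rightarrow> real"
  assumes "(g has_sum S) UNIV"
  shows "((\<lambda>n. if n \<in> range (to_nat :: 'k \<Rightarrow> nat) then g (from_nat n) else 0) has_sum S) UNIV"
proof -
  have "((\<lambda>n. g (from_nat n)) has_sum S) (range (to_nat :: 'k \<Rightarrow> nat))"
    using assms by (subst has_sum_reindex) (auto simp: o_def)
  then show ?thesis
    by (rule has_sum_cong_neutral[THEN iffD1, rotated -1]) auto
qed

text \<open>Any countable index type may serve for a new series: \<open>unit\<close> for a constant,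
  a disjoint sum for addition, pairs for multiplication, multi-indices for the given
  functions.\<close>

lemma power_series_boundI:
  fixes c :: "'k::countable \<Rightarrow> real"
  assumes "((\<lambda>k. \<bar>c k\<bar> * \<rho> ^ total_degree (\<alpha> k)) has_sum A) UNIV" and "A \<le> N"
    and "\<And>v. v \<in> polydisc p \<rho> \<Longrightarrow> ((\<lambda>k. c k * monomial_at p (\<alpha> k) v) has_sum h v) UNIV"
  shows "power_series_bound p \<rho> N h"
proof -
  define c' where "c' n = (if n \<in> range (to_nat :: 'k \<Rightarrow> nat) then c (from_nat n) else 0)" for n
  define \<alpha>' where "\<alpha>' n = \<alpha> (from_nat n)" for n
  have "((\<lambda>k. \<bar>c' k\<bar> * \<rho> ^ total_degree (\<alpha>' k)) has_sum A) UNIV"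
    using has_sum_from_nat[OF assms(1)]
    by (rule has_sum_cong[THEN iffD1, rotated]) (auto simp: c'_def \<alpha>'_def)
  moreover have "((\<lambda>k. c' k * monomial_at p (\<alpha>' k) v) has_sum h v) UNIV" if "v \<in> polydisc p \<rho>" for v
    using has_sum_from_nat[OF assms(3)[OF that]]
    by (rule has_sum_cong[THEN iffD1, rotated]) (auto simp: c'_def \<alpha>'_def)
  ultimately show ?thesis
    using \<open>A \<le> N\<close> unfolding power_series_bound_def by blast
qed

lemma power_series_bound_abs_le:
  assumes "power_series_bound p \<rho> N h" "v \<in> polydisc p \<rho>"
  shows "\<bar>h v\<bar> \<le> N"
proof -
  obtain c :: "nat \<Rightarrow> real" and \<alpha> A
    where c: "((\<lambda>k. \<bar>c k\<bar> * \<rho> ^ total_degree (\<alpha> k)) has_sum A) UNIV" "A \<le> N"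
      "((\<lambda>k. c k * monomial_at p (\<alpha> k) v) has_sum h v) UNIV"
    using assms unfolding power_series_bound_def by blast
  have le: "\<bar>c k * monomial_at p (\<alpha> k) v\<bar> \<le> \<bar>c k\<bar> * \<rho> ^ total_degree (\<alpha> k)" for k
    using assms(2) unfolding abs_mult polydisc_def
    by (intro mult_left_mono abs_monomial_at_le) (auto intro: less_imp_le)
  have "h v \<le> A"
    using c(3,1) by (rule has_sum_mono) (use le abs_le_iff in blast)
  moreover have "- h v \<le> A"
    by (rule has_sum_mono[OF _ c(1), of "\<lambda>k. - (c k * monomial_at p (\<alpha> k) v)"])
      (use le abs_le_iff c(3) in \<open>auto simp: has_sum_uminus simp del: mult_minus_left\<close>)
  ultimately show ?thesis using c(2) by linarith
qed

section \<open>Algebraic operations on bounded power series\<close>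

lemma power_series_bound_const:
  assumes "\<bar>a\<bar> \<le> N"
  shows "power_series_bound p \<rho> N (\<lambda>_. a)"
  by (rule power_series_boundI[where c = "\<lambda>_::unit. a" and \<alpha> = "\<lambda>_ _. 0" and A = "\<bar>a\<bar>"])
    (use assms in \<open>auto simp: total_degree_def monomial_at_def UNIV_unit intro!: has_sum_finiteI\<close>)

lemma power_series_bound_cong:
  assumes "power_series_bound p \<rho> N h" "\<And>v. v \<in> polydisc p \<rho> \<Longrightarrow> h v = g v"
  shows "power_series_bound p \<rho> N g"
  using assms unfolding power_series_bound_def by metis

lemma power_series_bound_mono:
  assumes "power_series_bound p \<rho> N h" "N \<le> N'" "0 \<le> \<sigma>" "\<sigma> \<le> \<rho>"
  shows "power_series_bound p \<sigma> N' h"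
proof -
  obtain c :: "nat \<Rightarrow> real" and \<alpha> A
    where c: "((\<lambda>k. \<bar>c k\<bar> * \<rho> ^ total_degree (\<alpha> k)) has_sum A) UNIV" "A \<le> N"
      "\<And>v. v \<in> polydisc p \<rho> \<Longrightarrow> ((\<lambda>k. c k * monomial_at p (\<alpha> k) v) has_sum h v) UNIV"
    using assms unfolding power_series_bound_def by blast
  have le: "\<bar>c k\<bar> * \<sigma> ^ total_degree (\<alpha> k) \<le> \<bar>c k\<bar> * \<rho> ^ total_degree (\<alpha> k)" for k
    using assms(3,4) by (intro mult_left_mono power_mono) auto
  have "(\<lambda>k. \<bar>c k\<bar> * \<sigma> ^ total_degree (\<alpha> k)) summable_on UNIV"
    using has_sum_imp_summable[OF c(1)]
    by (rule summable_on_comparison_test) (use le assms(3) in auto)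
  then obtain B where B: "((\<lambda>k. \<bar>c k\<bar> * \<sigma> ^ total_degree (\<alpha> k)) has_sum B) UNIV"
    by (auto simp: summable_on_def)
  have "B \<le> A" using B c(1) by (rule has_sum_mono) (rule le)
  with B c(2,3) assms(2) polydisc_mono[OF assms(4)] show ?thesis
    by (intro power_series_boundI[OF B]) (auto dest: subsetD)
qed

lemma power_series_bound_add:
  assumes "power_series_bound p \<rho> N h" "power_series_bound p \<rho> M g"
  shows "power_series_bound p \<rho> (N + M) (\<lambda>v. h v + g v)"
proof -
  obtain c :: "nat \<Rightarrow> real" and \<alpha> A
    where c: "((\<lambda>k. \<bar>c k\<bar> * \<rho> ^ total_degree (\<alpha> k)) has_sum A) UNIV" "A \<le> N"
      "\<And>v. v \<in> polydisc p \<rho> \<Longrightarrow> ((\<lambda>k. c k * monomial_at p (\<alpha> k) v) has_sum h v) UNIV"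
    using assms(1) unfolding power_series_bound_def by blast
  obtain d :: "nat \<Rightarrow> real" and \<beta> B
    where d: "((\<lambda>k. \<bar>d k\<bar> * \<rho> ^ total_degree (\<beta> k)) has_sum B) UNIV" "B \<le> M"
      "\<And>v. v \<in> polydisc p \<rho> \<Longrightarrow> ((\<lambda>k. d k * monomial_at p (\<beta> k) v) has_sum g v) UNIV"
    using assms(2) unfolding power_series_bound_def by blast
  have sum: "(q has_sum (s + t)) UNIV"
    if "((\<lambda>k. q (Inl k)) has_sum s) UNIV" "((\<lambda>k. q (Inr k)) has_sum t) UNIV"
    for q :: "nat + nat \<Rightarrow> real" and s t
  proof -
    have "(q has_sum s) (range Inl)" "(q has_sum t) (range Inr)"
      using that by (simp_all add: has_sum_reindex o_def)
    then have "(q has_sum (s + t)) (range Inl \<union> range Inr)"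
      by (intro has_sum_Un_disjoint) auto
    then show ?thesis by (simp add: UNIV_sum[symmetric])
  qed
  show ?thesis
  proof (rule power_series_boundI[where c = "case_sum c d" and \<alpha> = "case_sum \<alpha> \<beta>"])
    show "((\<lambda>k. \<bar>case_sum c d k\<bar> * \<rho> ^ total_degree (case_sum \<alpha> \<beta> k)) has_sum (A + B)) UNIV"
      by (rule sum) (use c(1) d(1) in auto)
    show "((\<lambda>k. case_sum c d k * monomial_at p (case_sum \<alpha> \<beta> k) v) has_sum (h v + g v)) UNIV"
      if "v \<in> polydisc p \<rho>" for v
      by (rule sum) (use c(3) d(3) that in auto)
    show "A + B \<le> N + M" using c(2) d(2) by simp
  qed
qed

lemma power_series_bound_sum:
  assumes "finite J" "\<And>j. j \<in> J \<Longrightarrow> power_series_bound p \<rho> (N j) (h j)"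
  shows "power_series_bound p \<rho> (\<Sum>j\<in>J. N j) (\<lambda>v. \<Sum>j\<in>J. h j v)"
  using assms
  by (induction J) (auto intro: power_series_bound_const power_series_bound_add)

text \<open>For real families unconditional summability is absolute. Hence the family of products is
  absolutely summable over pairs and may be summed first over \<open>l\<close>, then over
  \<open>k\<close>.\<close>

lemma has_sum_product:
  fixes f :: "'k \<Rightarrow> real" and g :: "'l \<Rightarrow> real"
  assumes "(f has_sum a) UNIV" "(g has_sum b) UNIV"
  shows "((\<lambda>(k, l). f k * g l) has_sum (a * b)) UNIV"
proof -
  have g: "(\<lambda>l. norm (g l)) summable_on UNIV" and f: "(\<lambda>k. norm (f k)) summable_on UNIV"
    using assms summable_on_iff_abs_summable_on_real has_sum_imp_summable by blast+
  have "(\<lambda>x. norm ((\<lambda>(k, l). f k * g l) x)) summable_on (UNIV \<times> UNIV)"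
    unfolding Infinite_Sum.abs_summable_on_Sigma_iff using f g
    by (auto simp: abs_mult infsum_cmult_right' intro!: summable_on_cmult_right summable_on_cmult_left)
  then have "(\<lambda>(k, l). f k * g l) summable_on (UNIV \<times> UNIV)"
    using abs_summable_summable by blast
  then have "((\<lambda>(k, l). f k * g l) has_sum (a * b)) (UNIV \<times> UNIV)"
    by (intro has_sum_SigmaI[where g = "\<lambda>k. f k * b"])
      (use assms in \<open>auto intro: has_sum_cmult_right has_sum_cmult_left\<close>)
  then show ?thesis by simp
qed

text \<open>Exponents add under multiplication of monomials, so total degrees add and the weighted
  coefficient sums multiply.\<close>

lemma power_series_bound_mult:
  assumes "power_series_bound p \<rho> N h" "power_series_bound p \<rho> M g" "0 \<le> \<rho>"
  shows "power_series_bound p \<rho> (N * M) (\<lambda>v. h v * g v)"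
proof -
  obtain c :: "nat \<Rightarrow> real" and \<alpha> A
    where c: "((\<lambda>k. \<bar>c k\<bar> * \<rho> ^ total_degree (\<alpha> k)) has_sum A) UNIV" "A \<le> N"
      "\<And>v. v \<in> polydisc p \<rho> \<Longrightarrow> ((\<lambda>k. c k * monomial_at p (\<alpha> k) v) has_sum h v) UNIV"
    using assms(1) unfolding power_series_bound_def by blast
  obtain d :: "nat \<Rightarrow> real" and \<beta> B
    where d: "((\<lambda>k. \<bar>d k\<bar> * \<rho> ^ total_degree (\<beta> k)) has_sum B) UNIV" "B \<le> M"
      "\<And>v. v \<in> polydisc p \<rho> \<Longrightarrow> ((\<lambda>k. d k * monomial_at p (\<beta> k) v) has_sum g v) UNIV"
    using assms(2) unfolding power_series_bound_def by blast
  have "0 \<le> A" "0 \<le> B"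
    using c(1) d(1) assms(3) by (auto intro: has_sum_nonneg)
  show ?thesis
  proof (rule power_series_boundI[where c = "\<lambda>(k, l). c k * d l" and \<alpha> = "\<lambda>(k, l) b. \<alpha> k b + \<beta> l b"])
    show "((\<lambda>k. \<bar>(case k of (k, l) \<Rightarrow> c k * d l)\<bar> *
        \<rho> ^ total_degree (case k of (k, l) \<Rightarrow> \<lambda>b. \<alpha> k b + \<beta> l b)) has_sum (A * B)) UNIV"
      using has_sum_product[OF c(1) d(1)]
      by (rule has_sum_cong[THEN iffD1, rotated])
        (auto simp: total_degree_def sum.distrib power_add abs_mult)
    show "((\<lambda>k. (case k of (k, l) \<Rightarrow> c k * d l) *
        monomial_at p (case k of (k, l) \<Rightarrow> \<lambda>b. \<alpha> k b + \<beta> l b) v) has_sum (h v * g v)) UNIV"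
      if "v \<in> polydisc p \<rho>" for v
      using has_sum_product[OF c(3) d(3), OF that that]
      by (rule has_sum_cong[THEN iffD1, rotated])
        (auto simp: monomial_at_def prod.distrib power_add)
    show "A * B \<le> N * M"
      using c(2) d(2) \<open>0 \<le> A\<close> \<open>0 \<le> B\<close> by (intro mult_mono) auto
  qed
qed

section \<open>Termwise differentiation and Cauchy estimates\<close>

lemma has_derivative_monomial_at:
  "(monomial_at p \<alpha> has_derivative
     (\<lambda>w. \<Sum>b\<in>Basis. (w \<bullet> b) * (\<alpha> b * monomial_at p (\<alpha>(b := \<alpha> b - 1)) v))) (at v)"
proof -
  \<comment> \<open>The truncated exponent \<open>\<alpha> b - 1\<close> is harmless at
    \<open>\<alpha> b = 0\<close>, where the factor \<open>\<alpha> b\<close> vanishes.\<close>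
  have eq: "(of_nat (\<alpha> b) * (w \<bullet> b) * ((v - p) \<bullet> b) ^ (\<alpha> b - 1)) * (\<Prod>j\<in>Basis - {b}. ((v - p) \<bullet> j) ^ \<alpha> j)
      = (w \<bullet> b) * (\<alpha> b * monomial_at p (\<alpha>(b := \<alpha> b - 1)) v)" if "b \<in> Basis" for b w
    using that unfolding monomial_at_def by (subst prod.remove[of _ b]) auto
  have lin: "((\<lambda>v. (v - p) \<bullet> b) has_derivative (\<lambda>w. w \<bullet> b)) (at v)" for b
    using has_derivative_inner_left[OF has_derivative_diff[OF has_derivative_ident has_derivative_const]]
    by simp
  have "((\<lambda>v. \<Prod>b\<in>Basis. ((v - p) \<bullet> b) ^ \<alpha> b) has_derivative
     (\<lambda>w. \<Sum>b\<in>Basis. (of_nat (\<alpha> b) * (w \<bullet> b) * ((v - p) \<bullet> b) ^ (\<alpha> b - 1)) *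
        (\<Prod>j\<in>Basis - {b}. ((v - p) \<bullet> j) ^ \<alpha> j))) (at v)"
    by (intro has_derivative_prod has_derivative_power lin)
  then have "((\<lambda>v. \<Prod>b\<in>Basis. ((v - p) \<bullet> b) ^ \<alpha> b) has_derivative
     (\<lambda>w. \<Sum>b\<in>Basis. (w \<bullet> b) * (\<alpha> b * monomial_at p (\<alpha>(b := \<alpha> b - 1)) v))) (at v)"
    by (rule has_derivative_eq_rhs) (intro ext sum.cong refl eq)
  then show ?thesis
    by (simp add: monomial_at_def[abs_def])
qed

text \<open>The left side is a single term of the binomial expansion of the right side. This is the
  Cauchy estimate for one monomial.\<close>

lemma power_derivative_le:
  fixes s \<epsilon> :: real
  assumes "0 \<le> s" "0 \<le> \<epsilon>"
  shows "n * \<epsilon> * s ^ (n - 1) \<le> (s + \<epsilon>) ^ n"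
proof (induction n)
  case (Suc n)
  have "Suc n * \<epsilon> * s ^ n = s * (n * \<epsilon> * s ^ (n - 1)) + \<epsilon> * s ^ n"
    by (cases n) (auto simp: algebra_simps)
  also have "\<dots> \<le> s * (s + \<epsilon>) ^ n + \<epsilon> * (s + \<epsilon>) ^ n"
    using assms Suc by (intro add_mono mult_left_mono power_mono) auto
  finally show ?case by (simp add: algebra_simps)
qed simp

text \<open>Cauchy's estimate carried out on coefficients: giving up \<open>\<epsilon>\<close> of
  the radius costs a factor \<open>1 / \<epsilon>\<close>. One summable majorant dominates all
  partial derivatives of each term, which justifies differentiating term by term and bounds the
  resulting series.\<close>

lemma power_series_bound_derivative:
  fixes p :: "'a::euclidean_space"
  assumes h: "power_series_bound p (\<sigma> + \<epsilon>) N h" and "0 < \<sigma>" "0 < \<epsilon>"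
  obtains h' where "\<And>v. v \<in> polydisc p \<sigma> \<Longrightarrow> (h has_derivative h' v) (at v)"
    and "\<And>b. b \<in> Basis \<Longrightarrow> power_series_bound p \<sigma> (N / \<epsilon>) (\<lambda>v. h' v b)"
proof -
  obtain c :: "nat \<Rightarrow> real" and \<alpha> A
    where c: "((\<lambda>k. \<bar>c k\<bar> * (\<sigma> + \<epsilon>) ^ total_degree (\<alpha> k)) has_sum A) UNIV" "A \<le> N"
      "\<And>v. v \<in> polydisc p (\<sigma> + \<epsilon>) \<Longrightarrow> ((\<lambda>k. c k * monomial_at p (\<alpha> k) v) has_sum h v) UNIV"
    using h unfolding power_series_bound_def by blast
  \<comment> \<open>The majorant: for a term of degree n, each partial derivative brings a factor at
    most n, and n \<sigma>^(n-1) \<le> (\<sigma> + \<epsilon>)^n / \<epsilon>.\<close>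
  define C where "C k = \<bar>c k\<bar> * (\<sigma> + \<epsilon>) ^ total_degree (\<alpha> k) / \<epsilon>" for k
  have C: "(C has_sum (A / \<epsilon>)) UNIV"
    unfolding C_def divide_inverse using c(1) by (rule has_sum_cmult_left)
  define d where "d b k = c k * \<alpha> k b" for b k
  define \<beta> where "\<beta> b k = (\<alpha> k)(b := \<alpha> k b - 1)" for b k
  have dC: "\<bar>d b k\<bar> * \<sigma> ^ total_degree (\<beta> b k) \<le> C k" if "b \<in> Basis" for b k
  proof (cases "\<alpha> k b = 0")
    case True
    then show ?thesis using assms by (simp add: d_def C_def)
  next
    case False
    let ?n = "total_degree (\<alpha> k)"
    have n: "total_degree (\<alpha> k) = \<alpha> k b + (\<Sum>j\<in>Basis - {b}. \<alpha> k j)"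
      using that unfolding total_degree_def by (subst sum.remove[of _ b]) auto
    have "total_degree (\<beta> b k) = (\<alpha> k b - 1) + (\<Sum>j\<in>Basis - {b}. \<alpha> k j)"
      using that unfolding total_degree_def \<beta>_def by (subst sum.remove[of _ b]) auto
    then have deg: "total_degree (\<beta> b k) = ?n - 1" using n False by simp
    have "\<alpha> k b * \<sigma> ^ (?n - 1) \<le> ?n * \<sigma> ^ (?n - 1)"
      using n assms by (intro mult_right_mono) (auto simp del: of_nat_sum)
    also have "\<dots> \<le> (\<sigma> + \<epsilon>) ^ ?n / \<epsilon>"
      using power_derivative_le[of \<sigma> \<epsilon> ?n] assms by (simp add: field_simps)
    finally have "\<bar>c k\<bar> * (\<alpha> k b * \<sigma> ^ (?n - 1)) \<le> \<bar>c k\<bar> * ((\<sigma> + \<epsilon>) ^ ?n / \<epsilon>)"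
      by (rule mult_left_mono) simp
    then show ?thesis
      by (simp add: deg d_def C_def abs_mult mult.assoc)
  qed
  have dm: "\<bar>d b k * monomial_at p (\<beta> b k) v\<bar> \<le> C k"
    if "b \<in> Basis" "v \<in> polydisc p \<sigma>" for b k v
  proof -
    have "\<bar>d b k * monomial_at p (\<beta> b k) v\<bar> \<le> \<bar>d b k\<bar> * \<sigma> ^ total_degree (\<beta> b k)"
      unfolding abs_mult using that
      by (intro mult_left_mono abs_monomial_at_le) (auto simp: polydisc_def intro: less_imp_le)
    with dC[OF that(1), of k] show ?thesis by linarith
  qed
  have Csum: "C summable_on UNIV" and Csummable: "summable C"
    using C has_sum_imp_summable has_sum_imp_sums sums_summable by blast+
  have sd: "(\<lambda>k. d b k * monomial_at p (\<beta> b k) v) summable_on UNIV"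
    if "b \<in> Basis" "v \<in> polydisc p \<sigma>" for b v
    by (rule abs_summable_summable, rule Infinite_Sum.abs_summable_on_comparison_test'[OF Csum])
      (use dm that in auto)
  define g where "g b v = (\<Sum>\<^sub>\<infinity>k. d b k * monomial_at p (\<beta> b k) v)" for b v
  have g: "((\<lambda>k. d b k * monomial_at p (\<beta> b k) v) has_sum g b v) UNIV"
    if "b \<in> Basis" "v \<in> polydisc p \<sigma>" for b v
    unfolding g_def using sd[OF that] by (rule has_sum_infsum)
  have pg: "power_series_bound p \<sigma> (N / \<epsilon>) (g b)" if b: "b \<in> Basis" for b
  proof -
    have "(\<lambda>k. \<bar>d b k\<bar> * \<sigma> ^ total_degree (\<beta> b k)) summable_on UNIV"
      using Csum by (rule summable_on_comparison_test) (use dC b assms in auto)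
    then obtain B where B: "((\<lambda>k. \<bar>d b k\<bar> * \<sigma> ^ total_degree (\<beta> b k)) has_sum B) UNIV"
      by (auto simp: summable_on_def)
    have "B \<le> A / \<epsilon>" using B C by (rule has_sum_mono) (use dC b in auto)
    also have "\<dots> \<le> N / \<epsilon>" using c(2) assms by (simp add: divide_right_mono)
    finally show ?thesis
      by (intro power_series_boundI[OF B]) (use g b in auto)
  qed
  define h' where "h' v w = (\<Sum>b\<in>Basis. (w \<bullet> b) * g b v)" for v w
  define f' where "f' k v w = (\<Sum>b\<in>Basis. (w \<bullet> b) * (d b k * monomial_at p (\<beta> b k) v))" for k v w
  have fd: "((\<lambda>v. c k * monomial_at p (\<alpha> k) v) has_derivative f' k v) (at v within polydisc p \<sigma>)" for k v
  proof (rule has_derivative_at_withinI)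
    have "((\<lambda>v. c k * monomial_at p (\<alpha> k) v) has_derivative
        (\<lambda>w. c k * (\<Sum>b\<in>Basis. (w \<bullet> b) * (\<alpha> k b * monomial_at p ((\<alpha> k)(b := \<alpha> k b - 1)) v)))) (at v)"
      by (intro has_derivative_mult_right has_derivative_monomial_at)
    then show "((\<lambda>v. c k * monomial_at p (\<alpha> k) v) has_derivative f' k v) (at v)"
      by (rule has_derivative_eq_rhs)
        (auto simp: f'_def d_def \<beta>_def sum_distrib_left algebra_simps)
  qed
  have fs: "(\<lambda>k. f' k v w) sums h' v w" if "v \<in> polydisc p \<sigma>" for v w
    unfolding f'_def h'_def
    by (intro sums_sum sums_mult has_sum_imp_sums g that)
  have fle: "\<bar>f' k v w\<bar> \<le> DIM('a) * C k * norm w" if "v \<in> polydisc p \<sigma>" for k v w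
  proof -
    have "\<bar>f' k v w\<bar> \<le> (\<Sum>b\<in>Basis. \<bar>(w \<bullet> b) * (d b k * monomial_at p (\<beta> b k) v)\<bar>)"
      unfolding f'_def by (rule sum_abs)
    also have "\<dots> \<le> (\<Sum>b\<in>(Basis::'a set). norm w * C k)"
      unfolding abs_mult[of "_ \<bullet> _"] using dm that
      by (intro sum_mono mult_mono Basis_le_norm) auto
    finally show ?thesis by (simp add: algebra_simps)
  qed
  \<comment> \<open>Uniform convergence of the derivatives in operator norm: the tail is at most the
    dimension times the tail of the series of \<open>C\<close>, independently of
    \<open>v\<close>.\<close>
  have unif: "\<forall>\<^sub>F n in sequentially. \<forall>v\<in>polydisc p \<sigma>. \<forall>w.
      norm ((\<Sum>k<n. f' k v w) - h' v w) \<le> e * norm w" if "0 < e" for e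
  proof -
    let ?D = "real DIM('a)"
    have "(\<lambda>n. \<Sum>k. C (k + n)) \<longlonglongrightarrow> 0"
      using suminf_exist_split2[OF Csummable] .
    moreover have "0 < e / ?D" using that by simp
    ultimately have "\<forall>\<^sub>F n in sequentially. (\<Sum>k. C (k + n)) < e / ?D"
      by (rule order_tendstoD)
    then show ?thesis
    proof eventually_elim
      case (elim n)
      show ?case
      proof (intro ballI allI)
        fix v w :: 'a assume v: "v \<in> polydisc p \<sigma>"
        have sC: "summable (\<lambda>k. ?D * C (k + n) * norm w)"
          using Csummable by (intro summable_mult summable_mult2) (simp add: summable_iff_shift)
        have "h' v w - (\<Sum>k<n. f' k v w) = (\<Sum>k. f' (k + n) v w)"
          using fs[OF v, of w] suminf_minus_initial_segment[of "\<lambda>k. f' k v w" n] by (auto simp: sums_iff)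
        also have "\<bar>\<dots>\<bar> \<le> (\<Sum>k. ?D * C (k + n) * norm w)"
          using norm_suminf_le[OF _ sC, of "\<lambda>k. f' (k + n) v w"] fle[OF v] by simp
        also have "\<dots> = ?D * (\<Sum>k. C (k + n)) * norm w"
          using Csummable by (simp add: suminf_mult suminf_mult2[symmetric] summable_iff_shift summable_mult)
        also have "\<dots> \<le> e * norm w"
          using elim by (intro mult_right_mono) (auto simp: field_simps)
        finally show "norm ((\<Sum>k<n. f' k v w) - h' v w) \<le> e * norm w"
          by (simp add: abs_minus_commute)
      qed
    qed
  qed
  have sub: "polydisc p \<sigma> \<subseteq> polydisc p (\<sigma> + \<epsilon>)"
    using assms by (intro polydisc_mono) simp
  have hs: "(\<lambda>k. c k * monomial_at p (\<alpha> k) v) sums h v" if "v \<in> polydisc p \<sigma>" for v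
    using c(3)[of v] that sub by (blast intro: has_sum_imp_sums)
  \<comment> \<open>The differentiation theorem yields some limit function, with derivatives within
    the polydisc. Uniqueness of sums identifies it with \<open>h\<close>, and openness of the
    polydisc gives full derivatives.\<close>
  obtain G where G: "\<forall>v\<in>polydisc p \<sigma>. (\<lambda>k. c k * monomial_at p (\<alpha> k) v) sums G v \<and>
      (G has_derivative h' v) (at v within polydisc p \<sigma>)"
    using has_derivative_series[OF convex_polydisc fd unif center_in_polydisc hs]
      center_in_polydisc[OF \<open>0 < \<sigma>\<close>] \<open>0 < \<sigma>\<close> by metis
  have GH: "G v = h v" if "v \<in> polydisc p \<sigma>" for v
    using G hs that sums_unique2 by blast
  have "(h has_derivative h' v) (at v)" if "v \<in> polydisc p \<sigma>" for v
  proof -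
    have "(G has_derivative h' v) (at v)"
      using G that at_within_open[OF that open_polydisc] by metis
    then show ?thesis
      by (rule has_derivative_transform_within_open[OF _ open_polydisc that]) (rule GH)
  qed
  moreover have "(\<lambda>v. h' v b) = g b" if "b \<in> Basis" for b
  proof
    fix v
    have "h' v b = (\<Sum>j\<in>Basis. if j = b then g b v else 0)"
      unfolding h'_def by (rule sum.cong) (use that in \<open>auto simp: inner_Basis\<close>)
    with that show "h' v b = g b v" by simp
  qed
  ultimately show ?thesis
    using pg by (intro that[of h']) simp_all
qed

section \<open>Growth of iterated Lie derivatives\<close>

text \<open>For the field \<open>ode_field f\<close> this is D in coordinate-free form; it agrees
  with \<open>D_op f\<close> wherever the function is differentiable.\<close>

definition lie_derivative ::
    "('a::euclidean_space \<Rightarrow> 'a) \<Rightarrow> ('a \<Rightarrow> real) \<Rightarrow> 'a \<Rightarrow> real" where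
  "lie_derivative F h v = frechet_derivative h (at v) (F v)"

lemma lie_derivative_eq:
  "(h has_derivative h') (at v) \<Longrightarrow> lie_derivative F h v = h' (F v)"
  unfolding lie_derivative_def using frechet_derivative_at by metis

lemma power_series_bound_differentiable:
  assumes "power_series_bound p \<rho> N h" "v \<in> polydisc p \<sigma>" "0 < \<sigma>" "\<sigma> < \<rho>"
  shows "h differentiable (at v)"
proof -
  have "power_series_bound p (\<sigma> + (\<rho> - \<sigma>)) N h" using assms(1) by simp
  then obtain h' where "(h has_derivative h' v) (at v)"
    by (rule power_series_bound_derivative) (use assms in auto)
  then show ?thesis by (rule differentiableI)
qed

text \<open>Expanding \<open>F v\<close> in the basis turns the derivative into a finite sum of
  products of a component, bounded by \<open>M b\<close>, and a partial derivative, bounded by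
  \<open>N / \<epsilon>\<close>.\<close>

lemma power_series_bound_lie_derivative:
  fixes p :: "'a::euclidean_space"
  assumes h: "power_series_bound p (\<sigma> + \<epsilon>) N h" and "0 < \<sigma>" "0 < \<epsilon>"
    and F: "\<And>b. b \<in> Basis \<Longrightarrow> power_series_bound p (\<sigma> + \<epsilon>) (M b) (\<lambda>v. F v \<bullet> b)"
  shows "power_series_bound p \<sigma> ((\<Sum>b\<in>Basis. M b) * (N / \<epsilon>)) (lie_derivative F h)"
proof -
  obtain h' where h': "\<And>v. v \<in> polydisc p \<sigma> \<Longrightarrow> (h has_derivative h' v) (at v)"
    "\<And>b. b \<in> Basis \<Longrightarrow> power_series_bound p \<sigma> (N / \<epsilon>) (\<lambda>v. h' v b)"
    using power_series_bound_derivative[OF assms(1-3)] by blast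
  have "power_series_bound p \<sigma> (\<Sum>b\<in>Basis. M b * (N / \<epsilon>)) (\<lambda>v. \<Sum>b\<in>Basis. (F v \<bullet> b) * h' v b)"
    using assms
    by (intro power_series_bound_sum power_series_bound_mult h' power_series_bound_mono[OF F]) auto
  moreover have "(\<Sum>b\<in>Basis. (F v \<bullet> b) * h' v b) = lie_derivative F h v" if "v \<in> polydisc p \<sigma>" for v
  proof -
    have lin: "linear (h' v)" using h'(1)[OF that] has_derivative_linear by blast
    have "h' v (F v) = h' v (\<Sum>b\<in>Basis. (F v \<bullet> b) *\<^sub>R b)" by (simp add: euclidean_representation)
    also have "\<dots> = (\<Sum>b\<in>Basis. (F v \<bullet> b) * h' v b)"
      using lin by (simp add: linear_sum linear_scale)
    finally show ?thesis using lie_derivative_eq[OF h'(1)[OF that]] by simp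
  qed
  ultimately show ?thesis
    unfolding sum_distrib_right by (rule power_series_bound_cong)
qed

text \<open>The quotient n^n / n! is one term of the exponential series of e^n, all of whose terms
  are nonnegative.\<close>

lemma self_power_le_exp_fact: "real n ^ n \<le> exp 1 ^ n * fact n"
proof -
  have "real n ^ n / fact n \<le> (\<Sum>k<Suc n. inverse (fact k) *\<^sub>R real n ^ k)"
    by (simp add: divide_inverse mult.commute sum_nonneg)
  also have "\<dots> \<le> exp (real n)"
    unfolding exp_def by (rule sum_le_suminf) (use summable_exp[of "real n"] in auto)
  finally show ?thesis
    using exp_of_nat_mult[of n "1 :: real"] by (simp add: field_simps)
qed

text \<open>
  Each of the \<open>m\<close> differentiations costs a shrinking of the polydisc; spending \<open>\<rho> / 2\<close> in \<open>m\<close>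
  equal steps gives the factor \<open>m\<^sup>m\<close>, which is geometric relative to \<open>m!\<close>.
\<close>

lemma power_series_bound_lie_derivative_funpow:
  fixes p :: "'a::euclidean_space"
  assumes h: "power_series_bound p \<rho> N h" and "0 < \<rho>"
    and F: "\<And>b. b \<in> Basis \<Longrightarrow> power_series_bound p \<rho> (M b) (\<lambda>v. F v \<bullet> b)"
  shows "power_series_bound p (\<rho> / 2) (N * (2 * exp 1 * (\<Sum>b\<in>Basis. M b) / \<rho>) ^ m * fact m)
    ((lie_derivative F ^^ m) h)"
proof (cases "m = 0")
  case True
  then show ?thesis using power_series_bound_mono[OF h order_refl, of "\<rho> / 2"] assms by simp
next
  case False
  let ?M = "\<Sum>b\<in>Basis. M b"
  define \<delta> where "\<delta> = \<rho> / (2 * m)"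
  have \<delta>: "0 < \<delta>" using False assms by (simp add: \<delta>_def)
  have pos: "0 \<le> N" "0 \<le> ?M"
    using power_series_bound_abs_le[OF h center_in_polydisc]
      power_series_bound_abs_le[OF F center_in_polydisc] \<open>0 < \<rho>\<close>
    by (auto intro!: sum_nonneg intro: order_trans[OF abs_ge_zero])
  \<comment> \<open>Since \<open>\<delta>\<close> depends on \<open>m\<close>, the induction keeps
    \<open>m\<close> fixed and runs over the number \<open>j\<close> of differentiations done so
    far, each using up one \<open>\<delta>\<close> of the radius.\<close>
  have "power_series_bound p (\<rho> - j * \<delta>) (N * (?M / \<delta>) ^ j) ((lie_derivative F ^^ j) h)"
    if "j \<le> m" for j
    using that
  proof (induction j)
    case 0
    then show ?case using h by simp
  next
    case (Suc j)
    have "real (Suc j) * \<delta> \<le> m * \<delta>"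
      using Suc.prems \<delta> by (intro mult_right_mono) auto
    also have "\<dots> < \<rho>" using False assms by (simp add: \<delta>_def)
    finally have r: "0 < \<rho> - Suc j * \<delta>" by simp
    have eq: "\<rho> - j * \<delta> = (\<rho> - Suc j * \<delta>) + \<delta>" by (simp add: algebra_simps)
    have "power_series_bound p (\<rho> - Suc j * \<delta>) (?M * (N * (?M / \<delta>) ^ j / \<delta>))
        (lie_derivative F ((lie_derivative F ^^ j) h))"
    proof (rule power_series_bound_lie_derivative[OF _ r \<delta>])
      show "power_series_bound p (\<rho> - Suc j * \<delta> + \<delta>) (N * (?M / \<delta>) ^ j) ((lie_derivative F ^^ j) h)"
        using Suc eq by simp
      show "power_series_bound p (\<rho> - Suc j * \<delta> + \<delta>) (M b) (\<lambda>v. F v \<bullet> b)" if "b \<in> Basis" for b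
        by (rule power_series_bound_mono[OF F[OF that]]) (use r \<delta> eq in auto)
    qed
    then show ?case by (simp add: field_simps)
  qed
  from this[of m] have "power_series_bound p (\<rho> - m * \<delta>) (N * (?M / \<delta>) ^ m) ((lie_derivative F ^^ m) h)"
    by simp
  moreover have "N * (?M / \<delta>) ^ m \<le> N * (2 * exp 1 * ?M / \<rho>) ^ m * fact m"
  proof -
    have "(?M / \<delta>) ^ m = (2 * ?M / \<rho>) ^ m * real m ^ m"
      using False by (simp add: \<delta>_def power_mult_distrib power_divide)
    also have "\<dots> \<le> (2 * ?M / \<rho>) ^ m * (exp 1 ^ m * fact m)"
      using pos assms by (intro mult_left_mono self_power_le_exp_fact) auto
    also have "\<dots> = (2 * exp 1 * ?M / \<rho>) ^ m * fact m"
      by (simp add: power_mult_distrib power_divide)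
    finally show ?thesis using pos by (simp add: mult_left_mono mult.assoc)
  qed
  moreover have "\<rho> - m * \<delta> = \<rho> / 2" using False by (simp add: \<delta>_def field_simps)
  ultimately show ?thesis
    using power_series_bound_mono[of p "\<rho> / 2" _ _ _ "\<rho> / 2"] assms by simp
qed

section \<open>Taylor series of one real variable\<close>

text \<open>The factorial in the bound cancels the one in the Taylor remainder, leaving a geometric
  error. The bound is indexed from \<open>Suc m\<close> because \<open>G 0\<close> will be a
  component of the solution and \<open>G (Suc m)\<close> the function D^m f_k along it.\<close>

lemma Taylor_sums_within:
  fixes G :: "nat \<Rightarrow> real \<Rightarrow> real"
  assumes I: "convex I" "t1 \<in> I"
    and G: "\<And>m t. t \<in> I \<Longrightarrow> (G m has_real_derivative G (Suc m) t) (at t within I)"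
    and "0 < \<delta>" "0 < K"
    and B: "\<And>m t. t \<in> I \<Longrightarrow> \<bar>t - t1\<bar> < \<delta> \<Longrightarrow> \<bar>G (Suc m) t\<bar> \<le> C * K ^ m * fact m"
  shows "\<exists>r>0. summable (\<lambda>m. \<bar>G m t1 / fact m\<bar> * r ^ m) \<and>
    (\<forall>t\<in>I. \<bar>t - t1\<bar> < r \<longrightarrow> (\<lambda>m. G m t1 / fact m * (t - t1) ^ m) sums G 0 t)"
proof -
  \<comment> \<open>The second entry makes the ratio K r at most 1/2; the first keeps t where the
    derivative bounds hold.\<close>
  define r where "r = min \<delta> (1 / (2 * K))"
  have r: "0 < r" "r \<le> \<delta>" "K * r \<le> 1 / 2"
    using assms by (auto simp: r_def min_def field_simps)
  have "0 \<le> C" using B[OF I(2), of 0] \<open>0 < \<delta>\<close> by simp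
  have "summable (\<lambda>m. \<bar>G (Suc m) t1 / fact (Suc m)\<bar> * r ^ Suc m)"
  proof (rule summable_comparison_test'[of "\<lambda>m. C * r * (1 / 2) ^ m" 0])
    show "summable (\<lambda>m. C * r * (1 / 2 :: real) ^ m)"
      by (intro summable_mult summable_geometric) simp
    show "norm (\<bar>G (Suc m) t1 / fact (Suc m)\<bar> * r ^ Suc m) \<le> C * r * (1 / 2) ^ m" for m
    proof -
      have "\<bar>G (Suc m) t1\<bar> \<le> C * K ^ m * fact m" using B[OF I(2)] \<open>0 < \<delta>\<close> by simp
      also have "\<dots> \<le> C * K ^ m * fact (Suc m)"
        using \<open>0 \<le> C\<close> \<open>0 < K\<close> by (intro mult_left_mono fact_mono) auto
      finally have "\<bar>G (Suc m) t1 / fact (Suc m)\<bar> \<le> C * K ^ m"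
        by (simp add: abs_divide divide_le_eq)
      then have "\<bar>G (Suc m) t1 / fact (Suc m)\<bar> * r ^ Suc m \<le> C * K ^ m * r ^ Suc m"
        using r by (intro mult_right_mono) auto
      also have "\<dots> = C * r * (K * r) ^ m" by (simp add: power_mult_distrib)
      also have "\<dots> \<le> C * r * (1 / 2) ^ m"
        using r \<open>0 \<le> C\<close> \<open>0 < K\<close> by (intro mult_left_mono power_mono) auto
      finally show ?thesis using r by simp
    qed
  qed
  then have "summable (\<lambda>m. \<bar>G m t1 / fact m\<bar> * r ^ m)"
    by (subst (asm) summable_Suc_iff)
  moreover have "(\<lambda>m. G m t1 / fact m * (t - t1) ^ m) sums G 0 t" if t: "t \<in> I" "\<bar>t - t1\<bar> < r" for t
  proof -
    let ?s = "\<lambda>n. \<Sum>m\<le>n. G m t1 / fact m * (t - t1) ^ m"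
    have "norm (G 0 t - ?s n) \<le> C * r * (1 / 2) ^ n" for n
    proof -
      \<comment> \<open>Taylor's theorem is applied on a convex set on which the bound is available
        throughout; at end points of \<open>I\<close> the derivatives remain one-sided.\<close>
      let ?S = "I \<inter> ball t1 \<delta>"
      have "norm (G 0 t - (\<Sum>i\<le>n. G i t1 * (t - t1) ^ i / fact i))
          \<le> (C * K ^ n * fact n) * norm (t - t1) ^ Suc n / fact n"
      proof (rule field_Taylor[of ?S])
        show "convex ?S" using I by (intro convex_Int) auto
        show "(G i has_real_derivative G (Suc i) u) (at u within ?S)" if "u \<in> ?S" for i u
          using G[of u i] that by (auto intro: DERIV_subset)
        show "norm (G (Suc n) u) \<le> C * K ^ n * fact n" if "u \<in> ?S" for u
          using B[of u n] that by (simp add: dist_real_def abs_minus_commute)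
      qed (use I t r \<open>0 < \<delta>\<close> in \<open>auto simp: dist_real_def abs_minus_commute\<close>)
      also have "\<dots> = C * K ^ n * \<bar>t - t1\<bar> ^ Suc n" by simp
      also have "\<dots> \<le> C * K ^ n * r ^ Suc n"
        using t \<open>0 \<le> C\<close> \<open>0 < K\<close> by (intro mult_left_mono power_mono) auto
      also have "\<dots> = C * r * (K * r) ^ n" by (simp add: power_mult_distrib)
      also have "\<dots> \<le> C * r * (1 / 2) ^ n"
        using r \<open>0 \<le> C\<close> \<open>0 < K\<close> by (intro mult_left_mono power_mono) auto
      finally show ?thesis by (simp add: mult.commute)
    qed
    moreover have "(\<lambda>n. C * r * (1 / 2) ^ n) \<longlonglongrightarrow> 0"
      by (intro tendsto_mult_right_zero LIMSEQ_realpow_zero) auto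
    ultimately have "(\<lambda>n. G 0 t - ?s n) \<longlonglongrightarrow> 0"
      by (rule Lim_null_comparison[OF always_eventually[OF allI]])
    then have "(\<lambda>n. G 0 t - (G 0 t - ?s n)) \<longlonglongrightarrow> G 0 t - 0"
      by (intro tendsto_diff tendsto_const)
    then show ?thesis unfolding sums_def_le by simp
  qed
  ultimately show ?thesis using r(1) by blast
qed

text \<open>Summation by parts writes the error as (1 - u) times the sum of d_n u^n, where d_n is
  the error of the n-th partial sum. The first N terms contribute at most (1 - u) K, which tends to
  0; the others contribute at most e/2.\<close>

lemma Abel_limit:
  fixes a :: "nat \<Rightarrow> real"
  assumes "summable a"
  shows "((\<lambda>u. \<Sum>m. a m * u ^ m) \<longlongrightarrow> suminf a) (at_left 1)"
proof (rule tendstoI)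
  fix e :: real assume "0 < e"
  define s where "s n = (\<Sum>m\<le>n. a m)" for n
  define d where "d n = s n - suminf a" for n
  have "s \<longlonglongrightarrow> suminf a"
    unfolding s_def using assms summable_LIMSEQ' by blast
  then have d0: "d \<longlonglongrightarrow> 0"
    unfolding d_def using LIM_zero_iff by blast
  then obtain N where N: "\<And>n. n \<ge> N \<Longrightarrow> \<bar>d n\<bar> < e / 2"
    using \<open>0 < e\<close> unfolding lim_sequentially dist_real_def by (metis diff_zero half_gt_zero)
  obtain B where B: "\<And>n. \<bar>d n\<bar> \<le> B"
    using d0 convergent_imp_Bseq[of d] unfolding Bseq_def convergent_def by auto
  define K where "K = (\<Sum>n<N. \<bar>d n\<bar>)"
  have "0 \<le> K" unfolding K_def by (simp add: sum_nonneg)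
  have est: "\<bar>(\<Sum>m. a m * u ^ m) - suminf a\<bar> \<le> (1 - u) * K + e / 2" if u: "0 < u" "u < 1" for u
  proof -
    have summable_a: "summable (\<lambda>m. norm (a m * u ^ m))"
      using powser_insidea[of a 1 u] assms u by simp
    have geo: "summable (\<lambda>n. u ^ n)" "(\<Sum>n. u ^ n) = 1 / (1 - u)"
      using u by (auto simp: summable_geometric suminf_geometric)
    have sd: "summable (\<lambda>n. \<bar>d n\<bar> * u ^ n)"
      by (rule summable_comparison_test'[of "\<lambda>n. B * u ^ n" 0])
        (use B u geo in \<open>auto intro!: mult_right_mono summable_mult\<close>)
    have sd': "summable (\<lambda>n. d n * u ^ n)"
      by (rule summable_rabs_cancel) (use sd u in \<open>simp add: abs_mult\<close>)
    \<comment> \<open>Summation by parts as a Cauchy product: multiplying by the geometric series 1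
      / (1 - u) replaces coefficients by partial sums.\<close>
    have "(\<lambda>n. \<Sum>m\<le>n. (a m * u ^ m) * u ^ (n - m)) sums ((\<Sum>m. a m * u ^ m) * (\<Sum>n. u ^ n))"
      by (rule Cauchy_product_sums[OF summable_a]) (use u geo in simp)
    moreover have "(\<Sum>m\<le>n. (a m * u ^ m) * u ^ (n - m)) = s n * u ^ n" for n
      unfolding s_def sum_distrib_right
      by (rule sum.cong) (auto simp: mult.assoc power_add[symmetric])
    ultimately have "(\<lambda>n. s n * u ^ n) sums ((\<Sum>m. a m * u ^ m) / (1 - u))"
      using geo by simp
    moreover have "(\<lambda>n. suminf a * u ^ n) sums (suminf a / (1 - u))"
      using sums_mult[OF summable_sums[OF geo(1)], of "suminf a"] geo(2) by simp
    ultimately have "(\<lambda>n. d n * u ^ n) sums (((\<Sum>m. a m * u ^ m) - suminf a) / (1 - u))"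
      unfolding d_def left_diff_distrib diff_divide_distrib by (rule sums_diff)
    then have eq: "(\<Sum>m. a m * u ^ m) - suminf a = (1 - u) * (\<Sum>n. d n * u ^ n)"
      using u by (simp add: sums_iff)
    have "\<bar>\<Sum>n. d n * u ^ n\<bar> \<le> (\<Sum>n. \<bar>d n\<bar> * u ^ n)"
      using summable_rabs[of "\<lambda>n. d n * u ^ n"] sd u by (simp add: abs_mult)
    also have "\<dots> \<le> (\<Sum>n. (if n < N then \<bar>d n\<bar> else 0) + (e / 2) * u ^ n)"
    proof (rule suminf_le)
      show "\<bar>d n\<bar> * u ^ n \<le> (if n < N then \<bar>d n\<bar> else 0) + (e / 2) * u ^ n" for n
      proof (cases "n < N")
        case True
        have "\<bar>d n\<bar> * u ^ n \<le> \<bar>d n\<bar> * 1"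
          using u by (intro mult_left_mono power_le_one) auto
        with True u \<open>0 < e\<close> show ?thesis by (smt (verit) mult_nonneg_nonneg half_gt_zero zero_le_power)
      next
        case False
        with N[of n] u show ?thesis by (auto intro!: mult_right_mono)
      qed
      show "summable (\<lambda>n. (if n < N then \<bar>d n\<bar> else 0) + (e / 2) * u ^ n)"
        by (intro summable_add summable_mult geo) (rule summable_finite[of "{..<N}"], auto)
    qed (rule sd)
    also have "\<dots> = K + (e / 2) / (1 - u)"
    proof -
      have "(\<lambda>n. if n \<in> {..<N} then \<bar>d n\<bar> else 0) sums K"
        unfolding K_def by (rule sums_If_finite_set) simp
      moreover have "(\<lambda>n. (e / 2) * u ^ n) sums ((e / 2) / (1 - u))"
        using sums_mult[OF summable_sums[OF geo(1)], of "e / 2"] geo(2) by simp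
      ultimately show ?thesis
        using sums_add sums_unique by fastforce
    qed
    finally have "(1 - u) * \<bar>\<Sum>n. d n * u ^ n\<bar> \<le> (1 - u) * (K + (e / 2) / (1 - u))"
      using u by (intro mult_left_mono) auto
    also have "\<dots> = (1 - u) * K + e / 2"
    proof -
      have "(1 - u) * (K + X / (1 - u)) = (1 - u) * K + X" for X
        using u by (simp add: distrib_left)
      then show ?thesis .
    qed
    finally show ?thesis
      unfolding eq abs_mult using u by simp
  qed
  have "((\<lambda>u. (1 - u) * K + e / 2) \<longlongrightarrow> (1 - 1) * K + e / 2) (at_left (1::real))"
    by (intro tendsto_intros)
  then have "\<forall>\<^sub>F u in at_left 1. (1 - u) * K + e / 2 < e"
    using \<open>0 < e\<close> by (intro order_tendstoD(2)[where y="(1 - 1) * K + e / 2"]) auto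
  moreover have "\<forall>\<^sub>F u in at_left (1::real). 0 < u \<and> u < 1"
    using eventually_at_left_real[of 0 1] by (auto elim: eventually_mono)
  ultimately show "\<forall>\<^sub>F u in at_left 1. dist (\<Sum>m. a m * u ^ m) (suminf a) < e"
    by eventually_elim (use est in \<open>fastforce simp: dist_real_def\<close>)
qed

section \<open>Analytic continuation along a segment\<close>

text \<open>Reading the real coefficients as complex ones makes the identity theorem for holomorphic
  functions available. Convergence at the one point at distance \<open>r\<close> from the centre
  already gives convergence in the open disc.\<close>

lemma powser_complex_of_real:
  fixes b :: "nat \<Rightarrow> real"
  assumes "0 < r" "\<And>u. u \<in> W \<Longrightarrow> (\<lambda>m. b m * (u - u0) ^ m) sums \<phi> u" "summable (\<lambda>m. b m * r ^ m)"
  shows "\<exists>G. G holomorphic_on ball (of_real u0) r \<and>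
    (\<forall>u\<in>W. \<bar>u - u0\<bar> < r \<longrightarrow> G (of_real u) = of_real (\<phi> u))"
proof -
  define G where "G z = (\<Sum>m. of_real (b m) * (z - of_real u0) ^ m)" for z :: complex
  have "(\<lambda>m. of_real (b m) * (z - of_real u0) ^ m) sums G z" if "z \<in> ball (of_real u0) r" for z
  proof -
    have "summable (\<lambda>m. of_real (b m) * (of_real r :: complex) ^ m)"
      using summable_of_real[OF assms(3), where 'a=complex] by simp
    then have "summable (\<lambda>m. of_real (b m) * (z - of_real u0) ^ m)"
      by (rule powser_inside) (use that assms(1) in \<open>simp add: dist_norm norm_minus_commute\<close>)
    then show ?thesis unfolding G_def by (rule summable_sums)
  qed
  then have "G holomorphic_on ball (of_real u0) r"
    by (rule power_series_holomorphic)
  moreover have "G (of_real u) = of_real (\<phi> u)" if "u \<in> W" for u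
  proof -
    have "(\<lambda>m. of_real (b m * (u - u0) ^ m) :: complex) sums of_real (\<phi> u)"
      using assms(2)[OF that] by (rule sums_of_real)
    then show ?thesis unfolding G_def by (simp add: sums_iff)
  qed
  ultimately show ?thesis by blast
qed

text \<open>The first point of disagreement before 1 cannot exist: local expansions carry agreement
  past any interior point. Continuity of \<open>\<phi>\<close> and Abel's theorem then settle the
  end point 1, where the series is only known to converge.\<close>

lemma locally_powser_eq_globally:
  fixes \<phi> :: "real \<Rightarrow> real"
  assumes cont: "continuous_on {0..1} \<phi>"
    and loc: "\<And>u0. u0 \<in> {0..1} \<Longrightarrow> \<exists>r>0. \<exists>b. summable (\<lambda>m. b m * r ^ m) \<and>
        (\<forall>u\<in>{0..1}. \<bar>u - u0\<bar> < r \<longrightarrow> (\<lambda>m. b m * (u - u0) ^ m) sums \<phi> u)"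
    and init: "\<exists>r>0. \<forall>u\<in>{0..1}. u < r \<longrightarrow> (\<lambda>m. a m * u ^ m) sums \<phi> u"
    and a: "summable a"
  shows "\<phi> 1 = suminf a"
proof -
  define S where "S u = (\<Sum>m. a m * u ^ m)" for u
  have Ssums: "(\<lambda>m. a m * u ^ m) sums S u" if "\<bar>u\<bar> < 1" for u
    unfolding S_def using powser_inside[of a 1 u] a that by (simp add: summable_sums)
  obtain H where H: "H holomorphic_on ball (of_real 0) 1"
    "\<And>u. \<bar>u\<bar> < 1 \<Longrightarrow> H (of_real u) = of_real (S u)"
    using powser_complex_of_real[of 1 "{-1<..<1}" a 0 S] Ssums a by (auto simp: abs_less_iff)
  \<comment> \<open>The expansion at \<open>t\<close> and the series at 0 coincide at points
    accumulating at \<open>t\<close> from the left, hence on a whole disc around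
    \<open>t\<close>.\<close>
  have continuation: "\<exists>r>0. \<forall>u\<in>{0..<1}. u < t + r \<longrightarrow> \<phi> u = S u"
    if t: "0 < t" "t < 1" and eq: "\<And>u. 0 \<le> u \<Longrightarrow> u < t \<Longrightarrow> \<phi> u = S u" for t
  proof -
    obtain r b where r: "0 < r" "summable (\<lambda>m. b m * r ^ m)"
      "\<forall>u\<in>{0..1}. \<bar>u - t\<bar> < r \<longrightarrow> (\<lambda>m. b m * (u - t) ^ m) sums \<phi> u"
      using loc[of t] t by auto
    obtain G where G: "G holomorphic_on ball (of_real t) r"
      "\<And>u. u \<in> {0..1} \<Longrightarrow> \<bar>u - t\<bar> < r \<Longrightarrow> G (of_real u) = of_real (\<phi> u)"
      using powser_complex_of_real[of r "{u\<in>{0..1}. \<bar>u - t\<bar> < r}" b t \<phi>] r by auto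
    \<comment> \<open>The disc must lie in the disc of the local expansion and in the unit disc, and
      its real points left of \<open>t\<close> must be nonnegative, where agreement is
      assumed.\<close>
    define \<rho> where "\<rho> = min r (min t (1 - t))"
    have \<rho>: "0 < \<rho>" "\<rho> \<le> r" "\<rho> \<le> t" "\<rho> \<le> 1 - t" using r t by (auto simp: \<rho>_def)
    have sub: "ball (complex_of_real t) \<rho> \<subseteq> ball (of_real 0) 1"
    proof
      fix z assume "z \<in> ball (complex_of_real t) \<rho>"
      then have "norm (z - of_real t) < 1 - t" using \<rho> by (simp add: dist_norm norm_minus_commute)
      then show "z \<in> ball (of_real 0) 1"
        using norm_triangle_sub[of z "of_real t"] t by simp
    qed
    have hol: "(\<lambda>z. G z - H z) holomorphic_on ball (of_real t) \<rho>"
      using G(1) H(1) sub \<rho> by (intro holomorphic_on_diff) (auto elim!: holomorphic_on_subset)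
    let ?U = "complex_of_real ` {t - \<rho><..<t}"
    have lim: "of_real t islimpt ?U"
      unfolding islimpt_approachable
    proof (intro allI impI)
      fix e :: real assume "0 < e"
      let ?u = "t - min e \<rho> / 2"
      show "\<exists>z\<in>?U. z \<noteq> of_real t \<and> dist z (of_real t) < e"
        by (rule bexI[of _ "of_real ?u"])
          (use \<open>0 < e\<close> \<rho> in \<open>auto simp: dist_norm simp flip: of_real_diff\<close>)
    qed
    have z0: "G z - H z = 0" if "z \<in> ?U" for z
      using that G(2) H(2) eq \<rho> t by (auto simp: abs_less_iff)
    have "\<phi> u = S u" if "u \<in> {0..<1}" "u < t + \<rho>" for u
    proof (cases "u < t")
      case False
      have "G (of_real u) - H (of_real u) = 0"
      proof (rule analytic_continuation[OF hol open_ball connected_ball _ _ lim z0])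
        show "?U \<subseteq> ball (of_real t) \<rho>"
          by (auto simp: dist_norm simp flip: of_real_diff)
        show "complex_of_real u \<in> ball (of_real t) \<rho>"
          using False that by (auto simp: dist_norm simp flip: of_real_diff)
      qed (use \<rho> in auto)
      then show ?thesis using G(2)[of u] H(2)[of u] that False \<rho> by simp
    qed (use eq that in auto)
    with \<rho> show ?thesis by blast
  qed
  have all: "\<phi> u = S u" if u: "u \<in> {0..<1}" for u
  proof (rule ccontr)
    assume neq: "\<phi> u \<noteq> S u"
    let ?B = "{v\<in>{0..<1}. \<phi> v \<noteq> S v}"
    \<comment> \<open>The infimum of the points of disagreement: it is positive by
      \<open>init\<close> and less than 1, so continuation past it contradicts its choice.\<close>
    define t where "t = Inf ?B"
    obtain r where r: "0 < r" "\<And>v. v \<in> {0..1} \<Longrightarrow> v < r \<Longrightarrow> (\<lambda>m. a m * v ^ m) sums \<phi> v"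
      using init by blast
    have rB: "r \<le> v" if "v \<in> ?B" for v
    proof (rule ccontr)
      assume "\<not> r \<le> v"
      then have "\<phi> v = S v" using r(2)[of v] that Ssums[of v] by (auto dest: sums_unique2)
      with that show False by simp
    qed
    have bdd: "bdd_below ?B" by (rule bdd_belowI[of _ 0]) auto
    have ne: "u \<in> ?B" using u neq by simp
    have "r \<le> t" unfolding t_def using ne rB by (intro cInf_greatest) auto
    moreover have "t \<le> u" unfolding t_def using ne bdd by (rule cInf_lower)
    moreover have "\<phi> v = S v" if "0 \<le> v" "v < t" for v
      using that \<open>t \<le> u\<close> u cInf_lower[OF _ bdd, of v] unfolding t_def by force
    ultimately obtain r' where r': "0 < r'" "\<forall>v\<in>{0..<1}. v < t + r' \<longrightarrow> \<phi> v = S v"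
      using continuation[of t] r u by auto
    then have "t + r' \<le> t"
      unfolding t_def using ne by (intro cInf_greatest) (force simp: t_def)+
    with r' show False by simp
  qed
  have "(\<phi> \<longlongrightarrow> \<phi> 1) (at_left 1)"
    using cont continuous_on_Icc_at_leftD by force
  moreover have "\<forall>\<^sub>F u in at_left (1::real). \<phi> u = S u"
    using eventually_at_left_real[of 0 "1 :: real"] by (auto elim!: eventually_mono intro: all)
  ultimately have "(S \<longlongrightarrow> \<phi> 1) (at_left 1)"
    by (rule Lim_transform_eventually)
  with Abel_limit[OF a] show ?thesis
    unfolding S_def by (intro tendsto_unique[of "at_left (1::real)"]) auto
qed

section \<open>Analytic systems of differential equations\<close>

text \<open>The autonomous form of the system: x becomes a coordinate with velocity 1, which
  accounts for the x-derivative in D.\<close>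

definition ode_field :: "('n::finite \<Rightarrow> real \<Rightarrow> real ^ 'n \<Rightarrow> real) \<Rightarrow> real \<times> (real ^ 'n) \<Rightarrow> real \<times> (real ^ 'n)" where
  "ode_field f v = (1, \<chi> k. f k (fst v) (snd v))"

lemma Basis_real_vec:
  "(Basis :: (real \<times> (real ^ 'n::finite)) set) = insert (1, 0) (range (\<lambda>i. (0, axis i 1)))"
  by (auto simp: Basis_prod_def Basis_vec_def)

lemma prod_Basis_real_vec:
  "(\<Prod>b\<in>(Basis :: (real \<times> (real ^ 'n::finite)) set). q b) = q (1, 0) * (\<Prod>i\<in>UNIV. q (0, axis i 1))"
proof -
  have "inj (\<lambda>i::'n. (0::real, axis i (1::real)))"
    by (auto simp: inj_on_def axis_eq_axis)
  moreover have "(1, 0) \<notin> range (\<lambda>i::'n. (0::real, axis i (1::real)))" by auto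
  ultimately show ?thesis
    unfolding Basis_real_vec by (simp add: prod.reindex o_def)
qed

text \<open>Unconditional convergence at one corner point is absolute convergence of the weighted
  coefficients, because every monomial takes the value \<rho>^degree there.\<close>

lemma real_analytic_at_imp_power_series_bound:
  fixes g :: "real \<Rightarrow> real ^ 'n::finite \<Rightarrow> real"
  assumes "real_analytic_at g x y"
  obtains \<rho> N where "0 < \<rho>" "power_series_bound (x, y) \<rho> N (case_prod g)"
proof -
  obtain c r where "0 < r" and
    c: "\<And>t u. \<bar>t - x\<bar> < r \<Longrightarrow> (\<forall>i. \<bar>u $ i - y $ i\<bar> < r) \<Longrightarrow>
      ((\<lambda>(j, a). c (j, a) * (t - x) ^ j * (\<Prod>i\<in>UNIV. (u $ i - y $ i) ^ a i)) has_sum g t u) UNIV"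
    using assms unfolding real_analytic_at_def by blast
  define ix where "ix b = (THE i. snd b = axis i (1::real))" for b :: "real \<times> (real ^ 'n)"
  \<comment> \<open>Among the basis vectors \<open>snd b = 0\<close> singles out the x-direction;
    \<open>ix\<close> recovers the component index of the others.\<close>
  define \<alpha> where "\<alpha> = (\<lambda>(j :: nat, a :: 'n \<Rightarrow> nat) (b :: real \<times> (real ^ 'n)). if snd b = 0 then j else a (ix b))"
  have ix: "ix (s, axis i 1) = i" for s i
    unfolding ix_def by (auto simp: axis_eq_axis)
  have ax: "axis i (1::real) \<noteq> 0" for i :: 'n
    by (simp add: axis_eq_0_iff)
  have mono: "monomial_at (x, y) (\<alpha> (j, a)) (t, u) = (t - x) ^ j * (\<Prod>i\<in>UNIV. (u $ i - y $ i) ^ a i)"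
    for j a t u
    unfolding monomial_at_def prod_Basis_real_vec by (simp add: \<alpha>_def ix ax inner_axis)
  have ser: "((\<lambda>k. c k * monomial_at (x, y) (\<alpha> k) v) has_sum case_prod g v) UNIV"
    if "\<And>b. b \<in> Basis \<Longrightarrow> \<bar>(v - (x, y)) \<bullet> b\<bar> < r" for v
  proof -
    obtain t u where v: "v = (t, u)" by fastforce
    have "\<bar>t - x\<bar> < r" using that[of "(1, 0)"] by (simp add: Basis_real_vec v)
    moreover have "\<bar>u $ i - y $ i\<bar> < r" for i
      using that[of "(0, axis i 1)"] by (simp add: Basis_real_vec v inner_axis)
    ultimately have "((\<lambda>(j, a). c (j, a) * (t - x) ^ j * (\<Prod>i\<in>UNIV. (u $ i - y $ i) ^ a i)) has_sum g t u) UNIV"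
      using c by blast
    moreover have "(\<lambda>(j, a). c (j, a) * (t - x) ^ j * (\<Prod>i\<in>UNIV. (u $ i - y $ i) ^ a i)) =
        (\<lambda>k. c k * monomial_at (x, y) (\<alpha> k) v)"
      by (auto simp: fun_eq_iff mono v)
    ultimately show ?thesis by (simp add: v)
  qed
  define \<rho> where "\<rho> = r / 2"
  have \<rho>: "0 < \<rho>" "\<rho> < r" using \<open>0 < r\<close> by (auto simp: \<rho>_def)
  \<comment> \<open>This corner lies outside the open polydisc of radius \<open>\<rho>\<close>, but
    inside the one of radius \<open>r\<close>, where the given series converges.\<close>
  have diag: "monomial_at (x, y) \<beta> ((x, y) + \<rho> *\<^sub>R One) = \<rho> ^ total_degree \<beta>" for \<beta>
    by (simp add: monomial_at_def total_degree_def power_sum)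
  have "((\<lambda>k. c k * monomial_at (x, y) (\<alpha> k) ((x, y) + \<rho> *\<^sub>R One)) has_sum
      case_prod g ((x, y) + \<rho> *\<^sub>R One)) UNIV"
    by (rule ser) (use \<rho> in simp)
  then have "(\<lambda>k. c k * \<rho> ^ total_degree (\<alpha> k)) summable_on UNIV"
    unfolding diag by (rule has_sum_imp_summable)
  then have "(\<lambda>k. norm (c k * \<rho> ^ total_degree (\<alpha> k))) summable_on UNIV"
    by (subst (asm) summable_on_iff_abs_summable_on_real)
  then have "((\<lambda>k. \<bar>c k\<bar> * \<rho> ^ total_degree (\<alpha> k)) has_sum
      (\<Sum>\<^sub>\<infinity>k. \<bar>c k\<bar> * \<rho> ^ total_degree (\<alpha> k))) UNIV"
    using \<rho> by (simp add: abs_mult)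
  then have "power_series_bound (x, y) \<rho> (\<Sum>\<^sub>\<infinity>k. \<bar>c k\<bar> * \<rho> ^ total_degree (\<alpha> k)) (case_prod g)"
  proof (rule power_series_boundI[OF _ order_refl])
    show "((\<lambda>k. c k * monomial_at (x, y) (\<alpha> k) v) has_sum case_prod g v) UNIV"
      if "v \<in> polydisc (x, y) \<rho>" for v
      by (rule ser) (use that \<rho> in \<open>auto simp: polydisc_def intro: less_trans\<close>)
  qed
  with \<rho> that show ?thesis by blast
qed

text \<open>Finitely many components admit a common radius and a common bound, so the growth
  estimate for Lie derivatives applies with the same constants to all \<open>k\<close> and
  \<open>m\<close>.\<close>

lemma analytic_system_bounds:
  fixes f :: "'n::finite \<Rightarrow> real \<Rightarrow> real ^ 'n \<Rightarrow> real"
  assumes "\<And>k. real_analytic_at (f k) x y"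
  shows "\<exists>\<rho> C K. 0 < \<rho> \<and> 0 < K \<and> (\<forall>v\<in>polydisc (x, y) \<rho>. \<forall>k m.
    (lie_derivative (ode_field f) ^^ m) (case_prod (f k)) differentiable (at v) \<and>
    \<bar>(lie_derivative (ode_field f) ^^ m) (case_prod (f k)) v\<bar> \<le> C * K ^ m * fact m)"
proof -
  have "\<forall>k. \<exists>\<rho> N. 0 < \<rho> \<and> power_series_bound (x, y) \<rho> N (case_prod (f k))"
    using real_analytic_at_imp_power_series_bound[OF assms] by metis
  then obtain R N0 where R: "\<And>k. 0 < R k" "\<And>k. power_series_bound (x, y) (R k) (N0 k) (case_prod (f k))"
    by metis
  define \<rho> where "\<rho> = Min (range R)"
  define N where "N = (\<Sum>k\<in>UNIV. \<bar>N0 k\<bar>)"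
  have \<rho>: "0 < \<rho>" "\<rho> \<le> R k" for k using R(1) by (auto simp: \<rho>_def)
  have N: "N0 k \<le> N" for k
    using member_le_sum[of k UNIV "\<lambda>k. \<bar>N0 k\<bar>"] by (simp add: N_def)
  have f: "power_series_bound (x, y) \<rho> N (case_prod (f k))" for k
    by (rule power_series_bound_mono[OF R(2) N _ \<rho>(2)]) (use \<rho> in \<open>auto intro: less_imp_le\<close>)
  \<comment> \<open>The 1 in the maximum covers the constant x-component of the field.\<close>
  have F: "power_series_bound (x, y) \<rho> (max 1 N) (\<lambda>v. ode_field f v \<bullet> b)" if b: "b \<in> Basis" for b
  proof -
    consider "b = (1, 0)" | i where "b = (0, axis i 1)"
      using b unfolding Basis_real_vec by blast
    then show ?thesis
    proof cases
      case 1
      then show ?thesis by (auto simp: ode_field_def intro: power_series_bound_const)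
    next
      case 2
      have "power_series_bound (x, y) \<rho> (max 1 N) (case_prod (f i))"
        by (rule power_series_bound_mono[OF f]) (use \<rho> in \<open>auto intro: less_imp_le\<close>)
      then show ?thesis
        by (rule power_series_bound_cong) (simp add: 2 ode_field_def inner_axis case_prod_beta)
    qed
  qed
  let ?K = "2 * exp 1 * (\<Sum>b\<in>(Basis :: (real \<times> (real ^ 'n)) set). max 1 N) / \<rho>"
  have P: "power_series_bound (x, y) (\<rho> / 2) (N * ?K ^ m * fact m)
      ((lie_derivative (ode_field f) ^^ m) (case_prod (f k)))" for k m
    by (rule power_series_bound_lie_derivative_funpow[OF f \<rho>(1) F])
  show ?thesis
  \<comment> \<open>The estimates hold at radius \<rho>/2; differentiability is obtained on a
    strictly smaller polydisc.\<close>
  proof (rule exI[of _ "\<rho> / 4"], rule exI[of _ N], rule exI[of _ ?K], intro conjI ballI allI)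
    show "0 < ?K" using \<rho> by (simp add: DIM_positive)
    show "\<bar>(lie_derivative (ode_field f) ^^ m) (case_prod (f k)) v\<bar> \<le> N * ?K ^ m * fact m"
      if "v \<in> polydisc (x, y) (\<rho> / 4)" for v k m
      by (rule power_series_bound_abs_le[OF P subsetD[OF polydisc_mono that]]) (use \<rho> in simp)
    show "(lie_derivative (ode_field f) ^^ m) (case_prod (f k)) differentiable (at v)"
      if "v \<in> polydisc (x, y) (\<rho> / 4)" for v k m
      by (rule power_series_bound_differentiable[OF P that]) (use \<rho> in auto)
  qed (use \<rho> in auto)
qed

section \<open>The operator D as a Lie derivative and as differentiation along solutions\<close>

text \<open>By the chain rule along coordinate lines the partial derivatives are the values of
  \<open>g'\<close> on basis vectors; linearity assembles them into the value on the field.\<close>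

lemma D_op_eq:
  fixes g :: "real \<Rightarrow> real ^ 'n::finite \<Rightarrow> real"
  assumes "(case_prod g has_derivative g') (at (x, y))"
  shows "D_op f g x y = g' (ode_field f (x, y))"
proof -
  have lin: "linear g'" using assms has_derivative_linear by blast
  have dir: "((\<lambda>t. case_prod g (w t)) has_real_derivative g' w') (at s)"
    if "(w has_vector_derivative w') (at s)" "w s = (x, y)" for w w' s
  proof -
    have "((\<lambda>t. case_prod g (w t)) has_derivative (\<lambda>h. g' (h *\<^sub>R w'))) (at s)"
      using diff_chain_at[of w "\<lambda>h. h *\<^sub>R w'" s "case_prod g" g'] that assms
      by (simp add: has_vector_derivative_def o_def)
    then show ?thesis
      unfolding has_field_derivative_def
      by (rule has_derivative_eq_rhs) (auto simp: linear_scale[OF lin] mult.commute)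
  qed
  have "((\<lambda>t. (t, y)) has_vector_derivative (1, 0)) (at x)"
    by (intro has_vector_derivative_Pair) (auto intro!: derivative_eq_intros)
  from dir[OF this] have "partial_x g x y = g' (1, 0)"
    unfolding partial_x_def by (simp add: DERIV_imp_deriv)
  moreover have "partial_y i g x y = g' (0, axis i 1)" for i
  proof -
    have eq: "(\<chi> j. if j = i then t else y $ j) = y + (t - y $ i) *\<^sub>R axis i 1" for t
      by (auto simp: vec_eq_iff axis_def)
    have "((\<lambda>t. (x, y + (t - y $ i) *\<^sub>R axis i 1)) has_vector_derivative (0, axis i 1)) (at (y $ i))"
      by (intro has_vector_derivative_Pair) (auto intro!: derivative_eq_intros)
    from dir[OF this] show ?thesis
      unfolding partial_y_def eq by (simp add: DERIV_imp_deriv)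
  qed
  moreover have "ode_field f (x, y) = (1, 0) + (\<Sum>i\<in>UNIV. f i x y *\<^sub>R (0, axis i 1))"
    by (auto simp: ode_field_def prod_eq_iff fst_sum snd_sum vec_eq_iff axis_def if_distrib cong: if_cong)
  moreover have "g' (0, c *\<^sub>R axis i 1) = c * g' (0, axis i 1)" for c i
    using linear_scale[OF lin, of c "(0, axis i 1)"] by simp
  ultimately show ?thesis
    unfolding D_op_def by (simp add: linear_add[OF lin] linear_sum[OF lin])
qed

text \<open>Differentiating once more requires the previous iterates to agree near the point, so the
  induction is over all points of the open set at once.\<close>

lemma D_op_funpow_eq:
  fixes f :: "'n::finite \<Rightarrow> real \<Rightarrow> real ^ 'n \<Rightarrow> real"
  assumes "open U"
    and diff: "\<And>m v. v \<in> U \<Longrightarrow> (lie_derivative (ode_field f) ^^ m) (case_prod g) differentiable (at v)"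
    and "(x, y) \<in> U"
  shows "(D_op f ^^ m) g x y = (lie_derivative (ode_field f) ^^ m) (case_prod g) (x, y)"
  using assms(3)
proof (induction m arbitrary: x y)
  case (Suc m)
  let ?L = "(lie_derivative (ode_field f) ^^ m) (case_prod g)"
  obtain L' where L': "(?L has_derivative L') (at (x, y))"
    using diff[OF Suc.prems] unfolding differentiable_def by blast
  then have "(case_prod ((D_op f ^^ m) g) has_derivative L') (at (x, y))"
    by (rule has_derivative_transform_within_open[OF _ assms(1) Suc.prems]) (use Suc.IH in auto)
  then show ?case
    using D_op_eq lie_derivative_eq[OF L'] by fastforce
qed simp

text \<open>The chain rule, since the curve (t, y(t)) has velocity
  \<open>ode_field f (t, y t)\<close>. Iterating it identifies the higher derivatives of a
  solution.\<close>

lemma has_derivative_along_solution: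
  fixes f :: "'n::finite \<Rightarrow> real \<Rightarrow> real ^ 'n \<Rightarrow> real"
  assumes y: "\<And>k. ((\<lambda>t. y t $ k) has_real_derivative f k t (y t)) (at t within I)"
    and h: "h differentiable (at (t, y t))"
  shows "((\<lambda>t. h (t, y t)) has_real_derivative lie_derivative (ode_field f) h (t, y t)) (at t within I)"
proof -
  obtain h' where h': "(h has_derivative h') (at (t, y t))"
    using h unfolding differentiable_def by blast
  have "(y has_vector_derivative (\<chi> k. f k t (y t))) (at t within I)"
    unfolding has_vector_derivative_def
  proof (subst has_derivative_componentwise_within, rule ballI)
    fix b :: "real ^ 'n" assume "b \<in> Basis"
    then obtain k where b: "b = axis k 1" by (auto simp: Basis_vec_def)
    show "((\<lambda>t. y t \<bullet> b) has_derivative (\<lambda>s. (s *\<^sub>R (\<chi> k. f k t (y t))) \<bullet> b)) (at t within I)"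
      using y[of k] by (simp add: b inner_axis has_field_derivative_def mult_commute_abs)
  qed
  then have "((\<lambda>t. (t, y t)) has_vector_derivative ode_field f (t, y t)) (at t within I)"
    unfolding ode_field_def fst_conv snd_conv
    by (intro has_vector_derivative_Pair) (auto intro!: derivative_eq_intros)
  then have "((\<lambda>t. h (t, y t)) has_derivative (\<lambda>s. h' (s *\<^sub>R ode_field f (t, y t)))) (at t within I)"
    using diff_chain_within[of "\<lambda>t. (t, y t)" _ t I h h'] h' has_derivative_at_withinI
    by (fastforce simp: has_vector_derivative_def o_def)
  then show ?thesis
    unfolding has_field_derivative_def lie_derivative_eq[OF h']
    by (rule has_derivative_eq_rhs)
      (auto simp: linear_scale[OF has_derivative_linear[OF h']] mult.commute)
qed


section \<open>Convergence of the series in \<open>alpha\<close> and the solution formula\<close>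

theorem theorem1:
  fixes f :: "'n::finite \<Rightarrow> real \<Rightarrow> real ^ 'n \<Rightarrow> real"
    and U :: "(real \<times> (real ^ 'n)) set"
    and x0 :: real and y0 :: "real ^ 'n"
    and I :: "real set" and y :: "real \<Rightarrow> real ^ 'n"
  assumes "open U"
    and "\<forall>k. real_analytic_on (f k) U"
    and "solves_ivp f U x0 y0 I y"
  shows "(\<exists>r>0. \<forall>x. \<bar>x - x0\<bar> < r \<longrightarrow> (\<forall>k. summable (\<lambda>m. D_term f x0 y0 k x (m + 2)))) \<and>
    (\<forall>x\<in>I. (x, euler_z f x0 y0 x) \<in> U \<and>
        (\<forall>k. f k x (euler_z f x0 y0 x) - f k x0 y0 \<noteq> 0) \<longrightarrow>
      (\<forall>k. summable (\<lambda>m. D_term f x0 y0 k x (m + 2)) \<longrightarrow>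
        y x $ k = y0 $ k + (x - x0) *
          (alpha f x0 y0 k x * f k x0 y0 +
           (1 - alpha f x0 y0 k x) * f k x (euler_z f x0 y0 x))))"
proof -
  have convI: "convex I" and x0: "x0 \<in> I" "y x0 = y0"
    and yU: "\<And>t. t \<in> I \<Longrightarrow> (t, y t) \<in> U"
    and y': "\<And>t k. t \<in> I \<Longrightarrow> ((\<lambda>t. y t $ k) has_real_derivative f k t (y t)) (at t within I)"
    using assms(3) by (auto simp: solves_ivp_def is_interval_convex)
  have an: "real_analytic_at (f k) t u" if "(t, u) \<in> U" for k t u
    using assms(2) that by (auto simp: real_analytic_on_def)
  define L where "L k m = (lie_derivative (ode_field f) ^^ m) (case_prod (f k))" for k m
  have L_diff: "L k m differentiable (at v)" if vU: "v \<in> U" for k m v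
  proof -
    obtain t u where v: "v = (t, u)" by fastforce
    obtain \<rho> where "0 < \<rho>" "\<forall>v\<in>polydisc (t, u) \<rho>. \<forall>k m. L k m differentiable (at v)"
      using analytic_system_bounds[of f t u, OF an[OF vU[unfolded v]]] unfolding L_def by blast
    then show ?thesis using center_in_polydisc v by blast
  qed
  have L_D: "L k m (t, u) = (D_op f ^^ m) (f k) t u" if "(t, u) \<in> U" for k m t u
    using D_op_funpow_eq[OF assms(1) L_diff[unfolded L_def] that] by (simp add: L_def)
  \<comment> \<open>The successive derivatives of the k-th component along the solution. The index
    is shifted by one: the derivative of order j + 1 is D^j f_k.\<close>
  define G where "G k m t = (case m of 0 \<Rightarrow> y t $ k | Suc j \<Rightarrow> L k j (t, y t))" for k m t
  have G': "(G k m has_real_derivative G k (Suc m) t) (at t within I)" if "t \<in> I" for k m t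
  proof (cases m)
    case 0
    then show ?thesis using y'[OF that] by (simp add: G_def[abs_def] L_def)
  next
    case (Suc j)
    have "((\<lambda>t. L k j (t, y t)) has_real_derivative lie_derivative (ode_field f) (L k j) (t, y t))
        (at t within I)"
      using y'[OF that] L_diff[OF yU[OF that]] by (rule has_derivative_along_solution)
    then show ?thesis by (simp add: Suc G_def[abs_def] L_def)
  qed
  have Taylor: "\<exists>r>0. summable (\<lambda>m. \<bar>G k m t1 / fact m\<bar> * r ^ m) \<and>
      (\<forall>t\<in>I. \<bar>t - t1\<bar> < r \<longrightarrow> (\<lambda>m. G k m t1 / fact m * (t - t1) ^ m) sums (y t $ k))"
    if t1: "t1 \<in> I" for k t1
  proof -
    obtain \<rho> C K where \<rho>: "0 < \<rho>" "0 < K" and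
      B: "\<forall>v\<in>polydisc (t1, y t1) \<rho>. \<forall>k m. \<bar>L k m v\<bar> \<le> C * K ^ m * fact m"
      using analytic_system_bounds[of f t1 "y t1", OF an[OF yU[OF t1]]] unfolding L_def by blast
    \<comment> \<open>Continuity of the solution carries the bounds from a polydisc around (t1,
      y(t1)) to an interval of parameters.\<close>
    have "continuous_on I (\<lambda>t. \<chi> k. y t $ k)"
      by (intro continuous_on_vec_lambda DERIV_continuous_on[OF y'])
    then have "continuous_on I (\<lambda>t. (t, y t))"
      by (intro continuous_on_Pair continuous_on_id) simp
    then have "((\<lambda>t. (t, y t)) \<longlongrightarrow> (t1, y t1)) (at t1 within I)"
      using t1 by (simp add: continuous_on_def)
    then have "\<forall>\<^sub>F t in at t1 within I. (t, y t) \<in> polydisc (t1, y t1) \<rho>"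
      by (rule topological_tendstoD) (use \<rho> open_polydisc center_in_polydisc in auto)
    then obtain \<delta> where \<delta>: "0 < \<delta>"
      "\<And>t. t \<in> I \<Longrightarrow> t \<noteq> t1 \<Longrightarrow> \<bar>t - t1\<bar> < \<delta> \<Longrightarrow> (t, y t) \<in> polydisc (t1, y t1) \<rho>"
      unfolding eventually_at dist_real_def by blast
    have bound: "\<bar>G k (Suc m) t\<bar> \<le> C * K ^ m * fact m" if "t \<in> I" "\<bar>t - t1\<bar> < \<delta>" for m t
      using B \<delta>(2)[of t] that center_in_polydisc[OF \<rho>(1)]
      by (cases "t = t1") (auto simp: G_def)
    have "\<exists>r>0. summable (\<lambda>m. \<bar>G k m t1 / fact m\<bar> * r ^ m) \<and>
        (\<forall>t\<in>I. \<bar>t - t1\<bar> < r \<longrightarrow> (\<lambda>m. G k m t1 / fact m * (t - t1) ^ m) sums G k 0 t)"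
      by (rule Taylor_sums_within[OF convI t1 G' \<delta>(1) \<rho>(2) bound])
    then show ?thesis by (simp add: G_def[of k 0])
  qed
  \<comment> \<open>The factor x - x0 in front of the bracket turns the terms of
    \<open>alpha\<close> into Taylor terms of the solution.\<close>
  have D_term_G: "(x - x0) * D_term f x0 y0 k x (Suc m) = G k (Suc m) x0 / fact (Suc m) * (x - x0) ^ Suc m"
    for k m x
    using L_D[of x0 y0] yU[OF x0(1)] x0(2) by (simp add: D_term_def G_def)
  show ?thesis
  proof (intro conjI ballI impI allI)
    have "\<exists>r>0. \<forall>x. \<bar>x - x0\<bar> < r \<longrightarrow> summable (\<lambda>m. D_term f x0 y0 k x (m + 2))" for k
    proof -
      obtain r where r: "0 < r" "summable (\<lambda>m. \<bar>G k m x0 / fact m\<bar> * r ^ m)"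
        using Taylor[OF x0(1)] by blast
      have "summable (\<lambda>m. D_term f x0 y0 k x (m + 2))" if x: "\<bar>x - x0\<bar> < r" for x
      \<comment> \<open>The factor x - x0 is to be cancelled below. At x = x0 all terms vanish,
        since the power in \<open>D_term\<close> has exponent m + 1 > 0.\<close>
      proof (cases "x = x0")
        case True
        then show ?thesis by (simp add: D_term_def)
      next
        case False
        have "summable (\<lambda>m. G k m x0 / fact m * (x - x0) ^ m)"
        proof (rule summable_comparison_test'[OF r(2), of 0])
          show "norm (G k m x0 / fact m * (x - x0) ^ m) \<le> \<bar>G k m x0 / fact m\<bar> * r ^ m" for m
            unfolding real_norm_def abs_mult power_abs
            using x by (intro mult_left_mono power_mono) auto
        qed
        then have "summable (\<lambda>m. G k (m + 2) x0 / fact (m + 2) * (x - x0) ^ (m + 2))"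
          by (subst summable_iff_shift)
        then have "summable (\<lambda>m. (x - x0) * D_term f x0 y0 k x (m + 2))"
          using D_term_G[of x k "m + 1" for m] by simp
        then show ?thesis using False by (simp add: summable_cmult_iff)
      qed
      with r show ?thesis by blast
    qed
    then obtain R where R: "\<And>k. 0 < R k"
      "\<And>k x. \<bar>x - x0\<bar> < R k \<Longrightarrow> summable (\<lambda>m. D_term f x0 y0 k x (m + 2))"
      by metis
    then show "\<exists>r>0. \<forall>x. \<bar>x - x0\<bar> < r \<longrightarrow> (\<forall>k. summable (\<lambda>m. D_term f x0 y0 k x (m + 2)))"
      by (intro exI[of _ "Min (range R)"]) auto
  next
    fix x k
    assume x: "x \<in> I" and
      z: "(x, euler_z f x0 y0 x) \<in> U \<and> (\<forall>k. f k x (euler_z f x0 y0 x) - f k x0 y0 \<noteq> 0)" and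
      s: "summable (\<lambda>m. D_term f x0 y0 k x (m + 2))"
    let ?S = "\<Sum>m. D_term f x0 y0 k x (m + 2)"
    have "y x $ k = y0 $ k + (x - x0) * (f k x0 y0 + ?S)"
    proof (cases "x = x0")
      case True
      then show ?thesis using x0 by simp
    next
      case False
      \<comment> \<open>The Taylor terms at x are the coefficients in u of the series along the
        segment \<open>t u\<close>, so x corresponds to u = 1 and \<open>summable a\<close> is
        convergence at the end point.\<close>
      define a where "a m = G k m x0 / fact m * (x - x0) ^ m" for m
      define t where "t u = x0 + u * (x - x0)" for u
      have tI: "t u \<in> I" if "u \<in> {0..1}" for u
        using convexD_alt[OF convI x0(1) x, of u] that by (simp add: t_def algebra_simps)
      have t_diff: "t u - t u0 = (x - x0) * (u - u0)" for u u0
        by (simp add: t_def algebra_simps)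
      have a2: "(\<lambda>m. a (m + 2)) = (\<lambda>m. (x - x0) * D_term f x0 y0 k x (m + 2))"
        using D_term_G[of x k "m + 1" for m] by (simp add: a_def)
      have "summable (\<lambda>m. a (m + 2))"
        unfolding a2 using s by (rule summable_mult)
      then have a: "summable a" by (subst (asm) summable_iff_shift)
      have loc: "\<exists>r>0. summable (\<lambda>m. (G k m (t u0) / fact m * (x - x0) ^ m) * r ^ m) \<and>
          (\<forall>u\<in>{0..1}. \<bar>u - u0\<bar> < r \<longrightarrow>
            (\<lambda>m. (G k m (t u0) / fact m * (x - x0) ^ m) * (u - u0) ^ m) sums (y (t u) $ k))"
        if u0: "u0 \<in> {0..1}" for u0
      proof -
        obtain r where r: "0 < r" "summable (\<lambda>m. \<bar>G k m (t u0) / fact m\<bar> * r ^ m)"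
          "\<And>s. s \<in> I \<Longrightarrow> \<bar>s - t u0\<bar> < r \<Longrightarrow>
            (\<lambda>m. G k m (t u0) / fact m * (s - t u0) ^ m) sums (y s $ k)"
          using Taylor[OF tI[OF u0]] by blast
        \<comment> \<open>The radius in the parameter u, which is stretched by the length of the
          segment.\<close>
        let ?r = "r / \<bar>x - x0\<bar>"
        have "summable (\<lambda>m. (G k m (t u0) / fact m * (x - x0) ^ m) * ?r ^ m)"
          by (rule summable_comparison_test'[OF r(2), of 0])
            (use r(1) False in \<open>simp add: abs_mult power_abs power_divide\<close>)
        moreover have "(\<lambda>m. (G k m (t u0) / fact m * (x - x0) ^ m) * (u - u0) ^ m) sums (y (t u) $ k)"
          if "u \<in> {0..1}" "\<bar>u - u0\<bar> < ?r" for u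
        proof -
          have "\<bar>t u - t u0\<bar> < r"
            using that(2) False by (simp add: t_diff abs_mult pos_less_divide_eq mult.commute)
          from r(3)[OF tI[OF that(1)] this] show ?thesis
            by (simp add: t_diff power_mult_distrib mult.assoc)
        qed
        moreover have "0 < ?r" using r(1) False by simp
        ultimately show ?thesis by blast
      qed
      have "y (t 1) $ k = suminf a"
      proof (rule locally_powser_eq_globally[OF _ _ _ a])
        have "continuous_on I (\<lambda>t. y t $ k)" by (rule DERIV_continuous_on[OF y'])
        moreover have "continuous_on {0..1} t" unfolding t_def by (intro continuous_intros)
        ultimately show "continuous_on {0..1} (\<lambda>u. y (t u) $ k)"
          by (rule continuous_on_compose2) (use tI in auto)
        show "\<exists>r>0. \<exists>b. summable (\<lambda>m. b m * r ^ m) \<and>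
            (\<forall>u\<in>{0..1}. \<bar>u - u0\<bar> < r \<longrightarrow> (\<lambda>m. b m * (u - u0) ^ m) sums (y (t u) $ k))"
          if "u0 \<in> {0..1}" for u0
          using loc[OF that] by (rule ex_forward) (elim conjE, intro conjI exI, assumption+)
        have "t 0 = x0" by (simp add: t_def)
        have "(0 :: real) \<in> {0..1}" by simp
        from loc[OF this] obtain r where "0 < r"
          and r: "\<forall>u\<in>{0..1}. \<bar>u - 0\<bar> < r \<longrightarrow> (\<lambda>m. a m * (u - 0) ^ m) sums (y (t u) $ k)"
          unfolding \<open>t 0 = x0\<close> a_def by blast
        have "(\<lambda>m. a m * u ^ m) sums (y (t u) $ k)" if "u \<in> {0..1}" "u < r" for u
          using r[rule_format, OF that(1)] that by simp
        with \<open>0 < r\<close> show "\<exists>r>0. \<forall>u\<in>{0..1}. u < r \<longrightarrow> (\<lambda>m. a m * u ^ m) sums (y (t u) $ k)"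
          by blast
      qed
      moreover have "t 1 = x" by (simp add: t_def)
      \<comment> \<open>The terms of order 0 and 1 give y_k0 + (x - x0) f_k(x0; y0); the series in
        \<open>alpha\<close> starts only at m = 2.\<close>
      moreover have "suminf a = a 0 + a 1 + (\<Sum>m. a (m + 2))"
        using suminf_split_initial_segment[OF a, of 2] by (simp add: eval_nat_numeral)
      moreover have "(\<Sum>m. a (m + 2)) = (x - x0) * ?S"
        unfolding a2 by (rule suminf_mult[OF s])
      moreover have "a 0 = y0 $ k" "a 1 = (x - x0) * f k x0 y0"
        using x0 by (simp_all add: a_def G_def L_def)
      ultimately have "y x $ k = y0 $ k + (x - x0) * f k x0 y0 + (x - x0) * ?S" by simp
      then show ?thesis by (simp only: distrib_left add.assoc)
    qed
    moreover have "alpha f x0 y0 k x * f k x0 y0 + (1 - alpha f x0 y0 k x) * f k x (euler_z f x0 y0 x)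
        = f k x0 y0 + ?S"
    \<comment> \<open>With d the nonzero denominator, the weighted mean is f_k(x0; y0) + (1 - alpha)
      d, and 1 - alpha is the series divided by d.\<close>
    proof -
      let ?d = "f k x (euler_z f x0 y0 x) - f k x0 y0"
      have "?d \<noteq> 0" using z by blast
      moreover have "alpha f x0 y0 k x * f k x0 y0 + (1 - alpha f x0 y0 k x) * f k x (euler_z f x0 y0 x)
        = f k x0 y0 + (1 - alpha f x0 y0 k x) * ?d" by (simp add: algebra_simps)
      ultimately show ?thesis by (simp add: alpha_def)
    qed
    ultimately show "y x $ k = y0 $ k + (x - x0) *
          (alpha f x0 y0 k x * f k x0 y0 +
           (1 - alpha f x0 y0 k x) * f k x (euler_z f x0 y0 x))"
      by simp
  qed
qed

end
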